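(* There are infinitely many minimally uninscribable order types.
   Context: The orientation of an ordered triple of points in the plane is positive if they appear in counterclockwise order around their convex hull, negative if clockwise, and zero if they are collinear. Two finite point sets (configurations) $P,Q\subset\mathbb{R}^2$ have the same order type if there is a bijection between them preserving the orientation of every ordered triple. An order type is an equivalence class of this relation, and an element of the class is said to realize the order type. The extreme points of a configuration $P$ are the vertices of its convex hull. A configuration (or its order type) is inscribable if it has the same order type as some configuration whose extreme points all lie on a circle. For finite $B\subseteq P\subset\mathbb{R}^2$, the pair $(P,B)$ is inscribable if there is a realization of (the order type of) $P$ in the closed unit disk, i.e. an orientation-preserving bijection from $P$ to a configuration contained in the closed unit disk, such that every point of $B$ is sent to a point on the unit circle. A configuration $P$ (or its order type) is minimally uninscribable if $P$ is not inscribable, but the pair $(P',B')$ is inscribable whenever $P'$ is a proper subset of $P$ and $B'\subseteq P'$ is a subset of the set of extreme points of $P$. *)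

theory Defs
  imports "HOL-Analysis.Analysis"
begin

text \<open>Sign of twice the signed area of the triangle \<open>p q r\<close>: \<open>1\<close> for a counterclockwise triple,
  \<open>-1\<close> for a clockwise one, \<open>0\<close> for a collinear one (in particular if points are repeated).\<close>

definition orientation :: "real^2 \<Rightarrow> real^2 \<Rightarrow> real^2 \<Rightarrow> real" where
  "orientation p q r =
     sgn ((q$1 - p$1) * (r$2 - p$2) - (q$2 - p$2) * (r$1 - p$1))"

definition orientation_preserving_on :: "(real^2) set \<Rightarrow> (real^2 \<Rightarrow> real^2) \<Rightarrow> bool" where
  "orientation_preserving_on P f \<longleftrightarrow>
     (\<forall>p\<in>P. \<forall>q\<in>P. \<forall>r\<in>P. orientation (f p) (f q) (f r) = orientation p q r)"

definition same_order_type :: "(real^2) set \<Rightarrow> (real^2) set \<Rightarrow> bool" where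
  "same_order_type P Q \<longleftrightarrow> (\<exists>f. bij_betw f P Q \<and> orientation_preserving_on P f)"

definition order_type_rel :: "((real^2) set \<times> (real^2) set) set" where
  "order_type_rel = {(P, Q). finite P \<and> finite Q \<and> same_order_type P Q}"

lemma equiv_order_type_rel: "equiv {P. finite P} order_type_rel"
proof (rule equivI)
  show "order_type_rel \<subseteq> {P. finite P} \<times> {P. finite P}"
    by (auto simp: order_type_rel_def)
  have "same_order_type P P" for P
    unfolding same_order_type_def orientation_preserving_on_def
    by (rule exI[of _ id]) auto
  then show "refl_on {P. finite P} order_type_rel"
    by (auto simp: order_type_rel_def refl_on_def)
  have "same_order_type Q P" if "same_order_type P Q" for P Q
  proof -
    from that obtain f where f: "bij_betw f P Q" "orientation_preserving_on P f"
      by (auto simp: same_order_type_def)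
    let ?g = "inv_into P f"
    have g: "bij_betw ?g Q P" using f(1) by (rule bij_betw_inv_into)
    have "orientation (?g p) (?g q) (?g r) = orientation p q r"
      if "p \<in> Q" "q \<in> Q" "r \<in> Q" for p q r
    proof -
      have "?g p \<in> P" "?g q \<in> P" "?g r \<in> P"
        using g that by (auto dest: bij_betwE)
      moreover have "f (?g p) = p" "f (?g q) = q" "f (?g r) = r"
        using f(1) that by (auto simp: bij_betw_inv_into_right)
      ultimately show ?thesis
        using f(2) unfolding orientation_preserving_on_def by metis
    qed
    with g show ?thesis
      unfolding same_order_type_def orientation_preserving_on_def by blast
  qed
  then show "sym order_type_rel"
    by (auto simp: order_type_rel_def sym_def)
  have "same_order_type P R" if PQ: "same_order_type P Q" and QR: "same_order_type Q R" for P Q R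
  proof -
    from PQ obtain f where f: "bij_betw f P Q" "orientation_preserving_on P f"
      by (auto simp: same_order_type_def)
    from QR obtain g where g: "bij_betw g Q R" "orientation_preserving_on Q g"
      by (auto simp: same_order_type_def)
    have "bij_betw (g \<circ> f) P R" using f(1) g(1) by (rule bij_betw_trans)
    moreover have "orientation_preserving_on P (g \<circ> f)"
      using f g(2) bij_betwE[OF f(1)] by (simp add: orientation_preserving_on_def)
    ultimately show ?thesis
      unfolding same_order_type_def by blast
  qed
  then show "trans order_type_rel"
    by (auto simp: order_type_rel_def intro!: transI)
qed

definition order_types :: "(real^2) set set set" where
  "order_types = {P. finite P} // order_type_rel"

definition extreme_points :: "(real^2) set \<Rightarrow> (real^2) set" where
  "extreme_points P = {x. x extreme_point_of (convex hull P)}"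

definition inscribable :: "(real^2) set \<Rightarrow> bool" where
  "inscribable P \<longleftrightarrow>
     (\<exists>Q. finite Q \<and> same_order_type P Q \<and> (\<exists>c \<rho>. 0 < \<rho> \<and> extreme_points Q \<subseteq> sphere c \<rho>))"

definition inscribable_pair :: "(real^2) set \<Rightarrow> (real^2) set \<Rightarrow> bool" where
  "inscribable_pair P B \<longleftrightarrow>
     (\<exists>f. inj_on f P \<and> orientation_preserving_on P f \<and>
          f ` P \<subseteq> cball 0 1 \<and> f ` B \<subseteq> sphere 0 1)"

text \<open>\<open>B'\<close> consists of extreme points of the full configuration \<open>P\<close>, not merely of \<open>P'\<close>.\<close>

definition minimally_uninscribable :: "(real^2) set \<Rightarrow> bool" where
  "minimally_uninscribable P \<longleftrightarrow>
     finite P \<and> \<not> inscribable P \<and>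
     (\<forall>P' B'. P' \<subset> P \<and> B' \<subseteq> P' \<and> B' \<subseteq> extreme_points P \<longrightarrow> inscribable_pair P' B')"

text \<open>The choice of the realization \<open>P\<close> is immaterial: a collinear configuration is inscribable,
  and for a non-collinear one an orientation-preserving bijection preserves extreme points.\<close>

definition minimally_uninscribable_order_type :: "(real^2) set set \<Rightarrow> bool" where
  "minimally_uninscribable_order_type T \<longleftrightarrow>
     T \<in> order_types \<and> (\<exists>P\<in>T. minimally_uninscribable P)"

end

theory Submission imports Defs begin

text \<open>Let a line meet a circle in \<open>a\<close> and \<open>b\<close>, and put \<open>\<rho> x = |xa|\<^sup>2 / |xb|\<^sup>2\<close> for \<open>x\<close> on the circle.
  A chord \<open>v w\<close> crossing the segment \<open>a b\<close> meets it in a point that depends only on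
  \<open>\<rho> v * \<rho> w\<close>. Hence for points \<open>U\<^sub>i\<close>, \<open>L\<^sub>i\<close> (\<open>i < m\<close>) of the circle on the two sides of the line and
  points \<open>M\<^sub>i\<close> on the line, with indices modulo \<open>m\<close>, the incidences of \<open>M\<^sub>i\<close> with \<open>U\<^sub>i L\<^sub>i\<close> and of
  \<open>M\<^sub>i\<^sub>-\<^sub>1\<close> with \<open>U\<^sub>i\<^sub>+\<^sub>1 L\<^sub>i\<close> are multiplicative equations along a cycle of length \<open>2 m\<close>, and all but
  one of them imply the last. Moving \<open>U\<^sub>0\<close> off the circle along \<open>U\<^sub>0 L\<^sub>0\<close> breaks exactly one
  incidence and gives an uninscribable order type. Once a vertex is deleted, the equations only form
  a path, so the same incidence can be broken by moving points along the circle. Therefore a minimal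
  uninscribable subconfiguration contains all \<open>2 m\<close> vertices.\<close>

section \<open>Chords of a circle\<close>

text \<open>Unlike its sign, the area is polynomial in the coordinates, hence open to algebraic
  identities and to limits.\<close>

definition area2 :: "real^2 \<Rightarrow> real^2 \<Rightarrow> real^2 \<Rightarrow> real" where
  "area2 p q r = (q$1 - p$1) * (r$2 - p$2) - (q$2 - p$2) * (r$1 - p$1)"

lemma orientation_eq: "orientation p q r = sgn (area2 p q r)"
  by (simp add: orientation_def area2_def)

lemma orientation_rotate: "orientation p q r = orientation q r p"
  unfolding orientation_def by (rule arg_cong[of _ _ sgn]) (simp add: algebra_simps)

lemma orientation_swap: "orientation q p r = - orientation p q r"
  unfolding orientation_def sgn_minus[symmetric]
  by (rule arg_cong[of _ _ sgn]) (simp add: algebra_simps)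

lemma area2_affine: "area2 p q (x + u *\<^sub>R (y - x)) = (1 - u) * area2 p q x + u * area2 p q y"
  by (simp add: area2_def algebra_simps)

lemma inner_real2: "inner (v::real^2) w = v$1 * w$1 + v$2 * w$2"
  by (simp add: inner_vec_def sum_2)

lemma collinear_param:
  assumes "area2 p q c = 0" "p \<noteq> q"
  obtains u where "c = p + u *\<^sub>R (q - p)"
proof (cases "q$1 = p$1")
  case True
  with assms have "q$2 \<noteq> p$2" by (auto simp: vec_eq_iff forall_2)
  moreover have "c$1 = p$1" using assms(1) True \<open>q$2 \<noteq> p$2\<close> by (simp add: area2_def)
  ultimately show ?thesis
    using True by (intro that[of "(c$2 - p$2) / (q$2 - p$2)"]) (auto simp: vec_eq_iff forall_2)
next
  case False
  then have "c$2 - p$2 = (c$1 - p$1) / (q$1 - p$1) * (q$2 - p$2)"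
    using assms(1) by (simp add: area2_def nonzero_eq_divide_eq eq_divide_eq mult.commute)
  with False show ?thesis
    by (intro that[of "(c$1 - p$1) / (q$1 - p$1)"]) (auto simp: vec_eq_iff forall_2)
qed

text \<open>Along the line \<open>x y\<close> the affine function \<open>area2 p q\<close> changes
  sign between \<open>x\<close> and \<open>y\<close>, so its zero \<open>c\<close> has a parameter
  strictly between 0 and 1.\<close>

lemma between_if_line_separates:
  assumes "area2 x y c = 0" "area2 p q c = 0" "area2 p q x < 0" "area2 p q y > 0"
  shows "c \<in> open_segment x y"
proof -
  have "x \<noteq> y" using assms by auto
  then obtain u where c: "c = x + u *\<^sub>R (y - x)" using assms collinear_param by blast
  have e: "(1 - u) * area2 p q x + u * area2 p q y = 0"
    using assms(2) by (simp add: c area2_affine)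
  have "u > 0"
  proof (rule ccontr)
    assume "\<not> u > 0"
    then have "(1 - u) * area2 p q x < 0" "u * area2 p q y \<le> 0"
      using assms by (auto simp: mult_less_0_iff mult_le_0_iff)
    with e show False by linarith
  qed
  moreover have "u < 1"
  proof (rule ccontr)
    assume "\<not> u < 1"
    then have "(1 - u) * area2 p q x \<ge> 0" "u * area2 p q y > 0"
      using assms by (auto simp: zero_le_mult_iff zero_less_mult_iff)
    with e show False by linarith
  qed
  ultimately show ?thesis
    using \<open>x \<noteq> y\<close> c by (auto simp: in_segment algebra_simps intro!: exI[of _ u])
qed

text \<open>Both determinants have rows \<open>(x, 1)\<close> with \<open>x\<close> a point of the unit circle, and pairing two such
  rows by the form \<open>diag(1, 1, -1)\<close> gives \<open>x \<bullet> y - 1\<close>, which vanishes for \<open>x = y\<close>.\<close>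

lemma area2_mult_circle:
  assumes "inner v v = 1" "inner w w = 1"
  shows "area2 v w a * area2 v w b =
    (1 - inner v w) * ((1 - inner w b) * (1 - inner v a) + (1 - inner v b) * (1 - inner w a)
       - (1 - inner v w) * (1 - inner a b))"
  using assms unfolding area2_def inner_real2 by algebra

lemma inner_less_1_circle:
  fixes v w :: "real^2"
  assumes "inner v v = 1" "inner w w = 1" "v \<noteq> w"
  shows "inner v w < 1"
proof -
  have "0 < inner (v - w) (v - w)" using assms(3) by simp
  also have "\<dots> = 2 - 2 * inner v w"
    using assms by (simp add: inner_diff_left inner_diff_right inner_commute)
  finally show ?thesis by simp
qed

text \<open>The squares of \<open>area2 v w a\<close> and \<open>area2 v w b\<close> factor into
  terms for \<open>v\<close> and terms for \<open>w\<close>, so the squared incidence equation is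
  multiplicative. Squaring loses nothing because the two areas have opposite signs.\<close>

lemma chord_through_iff:
  assumes circ: "inner v v = 1" "inner w w = 1" "inner a a = 1" "inner b b = 1"
    and sep: "area2 a b v < 0" "area2 a b w > 0"
    and u: "0 < u" "u < 1"
  shows "area2 v w (a + u *\<^sub>R (b - a)) = 0 \<longleftrightarrow>
    (1 - inner v a) / (1 - inner v b) * ((1 - inner w a) / (1 - inner w b)) = (u / (1 - u))\<^sup>2"
proof -
  define A B where "A = area2 v w a" and "B = area2 v w b"
  have ne: "v \<noteq> w" "v \<noteq> a" "v \<noteq> b" "w \<noteq> a" "w \<noteq> b" "a \<noteq> b"
    using sep by (auto simp: area2_def algebra_simps)
  have pos: "1 - inner v w > 0" "1 - inner v a > 0" "1 - inner v b > 0" "1 - inner w a > 0"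
    "1 - inner w b > 0" "1 - inner a b > 0"
    using circ ne inner_less_1_circle by auto
  have A2: "A\<^sup>2 = 2 * (1 - inner v w) * ((1 - inner v a) * (1 - inner w a))"
    unfolding A_def power2_eq_square area2_mult_circle[OF circ(1,2)]
    by (simp add: circ algebra_simps)
  have B2: "B\<^sup>2 = 2 * (1 - inner v w) * ((1 - inner v b) * (1 - inner w b))"
    unfolding B_def power2_eq_square area2_mult_circle[OF circ(1,2)]
    by (simp add: circ algebra_simps)
  \<comment> \<open>The second factor in \<open>area2_mult_circle\<close> does not change when the
    pairs \<open>v, w\<close> and \<open>a, b\<close> are exchanged. Hence \<open>v w\<close>
    separates \<open>a\<close> from \<open>b\<close> because \<open>a b\<close> separates
    \<open>v\<close> from \<open>w\<close>.\<close>
  have "A * B * (1 - inner a b) = area2 a b v * area2 a b w * (1 - inner v w)"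
    unfolding A_def B_def
    by (subst area2_mult_circle[OF circ(1,2)], subst area2_mult_circle[OF circ(3,4)])
       (simp add: inner_commute algebra_simps)
  also have "\<dots> < 0" using sep pos by (simp add: mult_neg_pos)
  finally have AB: "A * B < 0" using pos by (simp add: mult_less_0_iff)
  have "area2 v w (a + u *\<^sub>R (b - a)) = 0 \<longleftrightarrow> (1 - u) * A + u * B = 0"
    by (simp add: area2_affine A_def B_def)
  also have "\<dots> \<longleftrightarrow> ((1 - u) * A)\<^sup>2 = (u * B)\<^sup>2"
  proof
    assume "(1 - u) * A + u * B = 0"
    then have "(1 - u) * A = - (u * B)" by linarith
    then show "((1 - u) * A)\<^sup>2 = (u * B)\<^sup>2" by simp
  next
    assume "((1 - u) * A)\<^sup>2 = (u * B)\<^sup>2"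
    \<comment> \<open>The other square root is impossible: multiplied by \<open>B\<close>, it would
      equate a negative number with a nonnegative one.\<close>
    moreover have "(1 - u) * A \<noteq> u * B"
    proof
      assume "(1 - u) * A = u * B"
      then have "((1 - u) * A) * B = (u * B) * B" by (rule arg_cong)
      then have "(1 - u) * (A * B) = u * B\<^sup>2" by (simp only: power2_eq_square mult.assoc)
      moreover have "(1 - u) * (A * B) < 0" using AB u by (simp add: mult_less_0_iff)
      moreover have "u * B\<^sup>2 \<ge> 0" using u by simp
      ultimately show False by linarith
    qed
    ultimately show "(1 - u) * A + u * B = 0" by (simp add: power2_eq_iff)
  qed
  also have "\<dots> \<longleftrightarrow> 2 * (1 - inner v w) * ((1 - u)\<^sup>2 * ((1 - inner v a) * (1 - inner w a))) =
      2 * (1 - inner v w) * (u\<^sup>2 * ((1 - inner v b) * (1 - inner w b)))"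
    by (simp only: power_mult_distrib A2 B2 ac_simps)
  also have "\<dots> \<longleftrightarrow> (1 - u)\<^sup>2 * ((1 - inner v a) * (1 - inner w a)) =
       u\<^sup>2 * ((1 - inner v b) * (1 - inner w b))"
    using pos by simp
  also have "\<dots> \<longleftrightarrow>
    (1 - inner v a) / (1 - inner v b) * ((1 - inner w a) / (1 - inner w b)) = (u / (1 - u))\<^sup>2"
    using pos u by (simp add: power_divide frac_eq_eq) (simp add: ac_simps)
  finally show ?thesis .
qed

section \<open>A closure theorem for inscribed polygons\<close>

text \<open>Labels instead of points make all realizations of one order type families over the same
  index set.\<close>

datatype idx = Up nat | Low nat | Mid nat

definition verts :: "nat \<Rightarrow> idx set" where
  "verts m = Up ` {..<m} \<union> Low ` {..<m}"

definition inds :: "nat \<Rightarrow> idx set" where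
  "inds m = verts m \<union> Mid ` {..<m}"

text \<open>The predecessor modulo \<open>m\<close>; truncated subtraction alone would send 0 to
  itself.\<close>

definition pr :: "nat \<Rightarrow> nat \<Rightarrow> nat" where
  "pr m i = (if i = 0 then m - 1 else i - 1)"

lemma inds_simps [simp]:
  "Up i \<in> inds m \<longleftrightarrow> i < m" "Low i \<in> inds m \<longleftrightarrow> i < m" "Mid i \<in> inds m \<longleftrightarrow> i < m"
  "Up i \<in> verts m \<longleftrightarrow> i < m" "Low i \<in> verts m \<longleftrightarrow> i < m" "Mid i \<notin> verts m"
  by (auto simp: inds_def verts_def)

lemma finite_verts [simp]: "finite (verts m)" and finite_inds [simp]: "finite (inds m)"
  by (simp_all add: verts_def inds_def)

lemma verts_subset_inds: "verts m \<subseteq> inds m"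
  by (simp add: inds_def)

lemma card_verts: "card (verts m) = 2 * m"
  unfolding verts_def
  by (subst card_Un_disjoint) (auto simp: card_image inj_on_def)

text \<open>The last clause is the case \<open>i = m - 1\<close> of the clause before it, read
  modulo \<open>m\<close> and negated: the cycle fails to close.\<close>

definition necklace :: "nat \<Rightarrow> (idx \<Rightarrow> real^2) \<Rightarrow> bool" where
  "necklace m z \<longleftrightarrow>
     (\<forall>k<m. area2 (z (Mid 0)) (z (Mid 1)) (z (Mid k)) = 0) \<and>
     (\<forall>i<m. area2 (z (Mid 0)) (z (Mid 1)) (z (Up i)) < 0) \<and>
     (\<forall>i<m. area2 (z (Mid 0)) (z (Mid 1)) (z (Low i)) > 0) \<and>
     (\<forall>i<m. area2 (z (Up i)) (z (Low i)) (z (Mid i)) = 0) \<and>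
     (\<forall>i. Suc i < m \<longrightarrow> area2 (z (Up (Suc i))) (z (Low i)) (z (Mid (pr m i))) = 0) \<and>
     area2 (z (Up 0)) (z (Low (m - 1))) (z (Mid (m - 2))) \<noteq> 0"

lemma necklace_between:
  assumes "necklace m z" "k < m"
  shows "z (Mid k) \<in> open_segment (z (Up k)) (z (Low k))"
  using assms unfolding necklace_def by (intro between_if_line_separates) auto

text \<open>The points \<open>Mid k\<close> lie inside the disk, so their line is a secant, and
  \<open>chord_through_iff\<close> turns incidences into equations
  \<open>r i * l j = \<kappa> k\<close>. The \<open>2 * m - 1\<close> equations at hand telescope to
  the one that is denied.\<close>

lemma necklace_not_inscribed:
  assumes m: "m \<ge> 3" and z: "necklace m z"
    and circ: "\<And>i. i < m \<Longrightarrow> z (Up i) \<in> sphere 0 1" "\<And>i. i < m \<Longrightarrow> z (Low i) \<in> sphere 0 1"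
  shows False
proof -
  define p q where "p = z (Mid 0)" and "q = z (Mid 1)"
  have mid: "norm (z (Mid k)) < 1" if "k < m" for k
    using dist_decreases_open_segment[OF necklace_between[OF z that], of 0] circ[OF that] by auto
  have "area2 p q (z (Up 0)) < 0" using z m by (simp add: necklace_def p_def q_def)
  then have pq: "p \<noteq> q" by (auto simp: area2_def)
  have "p \<in> interior (ball 0 1)" using mid[of 0] m by (simp add: p_def)
  then obtain d1 d2 where d1: "d1 > 0" "p + d1 *\<^sub>R (p - q) \<in> frontier (ball 0 1)"
    and d2: "d2 > 0" "p + d2 *\<^sub>R (q - p) \<in> frontier (ball 0 1)"
    using ray_to_frontier[of "ball (0::real^2) 1" p] pq bounded_ball
    by (metis right_minus_eq)
  \<comment> \<open>\<open>a\<close> lies behind \<open>p\<close> and \<open>b\<close> ahead of it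
    in the direction of \<open>q\<close>, so \<open>area2 a b\<close> is a positive multiple of
    \<open>area2 p q\<close> and the sides stay the same.\<close>
  define a b where "a = p + d1 *\<^sub>R (p - q)" and "b = p + d2 *\<^sub>R (q - p)"
  have ab: "inner a a = 1" "inner b b = 1"
    using d1(2) d2(2) by (simp_all add: a_def b_def frontier_ball dot_square_norm)
  have area_ab: "area2 a b x = (d1 + d2) * area2 p q x" for x
    by (simp add: a_def b_def area2_def algebra_simps)
  have on_line: "\<exists>u. 0 < u \<and> u < 1 \<and> z (Mid k) = a + u *\<^sub>R (b - a)" if k: "k < m" for k
  proof -
    have "a \<noteq> b"
    proof
      assume "a = b"
      then have "(d1 + d2) *\<^sub>R (q - p) = 0" by (simp add: a_def b_def algebra_simps)
      with d1 d2 pq show False by simp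
    qed
    moreover have "area2 a b (z (Mid k)) = 0"
      using z k by (simp add: area_ab necklace_def p_def q_def)
    ultimately obtain u where u: "z (Mid k) = a + u *\<^sub>R (b - a)" using collinear_param by blast
    have "inner (z (Mid k)) (z (Mid k)) < 1"
      using mid[OF k] by (simp add: dot_square_norm power_less_one_iff)
    \<comment> \<open>This is the power of the point with respect to the circle: lying inside
      amounts to \<open>0 < u * (1 - u)\<close>.\<close>
    also have "inner (z (Mid k)) (z (Mid k)) = 1 - 2 * (1 - inner a b) * (u * (1 - u))"
      using ab unfolding u inner_add_left inner_add_right inner_diff_left inner_diff_right
        inner_scaleR_left inner_scaleR_right by (simp add: inner_commute algebra_simps)
    finally have "0 < 2 * (1 - inner a b) * (u * (1 - u))" by simp
    moreover have "inner a b < 1" using ab \<open>a \<noteq> b\<close> inner_less_1_circle by blast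
    ultimately have "0 < u * (1 - u)" by (simp add: zero_less_mult_iff)
    then have "0 < u \<and> u < 1" by (auto simp: zero_less_mult_iff)
    with u show ?thesis by blast
  qed
  then obtain u where u: "\<And>k. k < m \<Longrightarrow> 0 < u k" "\<And>k. k < m \<Longrightarrow> u k < 1"
    "\<And>k. k < m \<Longrightarrow> z (Mid k) = a + u k *\<^sub>R (b - a)" by metis
  define \<rho> where "\<rho> x = (1 - inner x a) / (1 - inner x b)" for x
  define r l \<kappa> where "r i = \<rho> (z (Up i))" and "l i = \<rho> (z (Low i))"
    and "\<kappa> k = (u k / (1 - u k))\<^sup>2" for i k
  have incid: "area2 (z (Up i)) (z (Low j)) (z (Mid k)) = 0 \<longleftrightarrow> r i * l j = \<kappa> k"
    if "i < m" "j < m" "k < m" for i j k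
  proof -
    have "area2 a b (z (Up i)) < 0" "area2 a b (z (Low j)) > 0"
      using z that d1 d2 by (auto simp: area_ab necklace_def p_def q_def mult_less_0_iff)
    moreover have "inner (z (Up i)) (z (Up i)) = 1" "inner (z (Low j)) (z (Low j)) = 1"
      using circ that by (auto simp: dot_square_norm)
    ultimately show ?thesis
      using chord_through_iff[of "z (Up i)" "z (Low j)" a b "u k"] ab u that
      by (simp add: r_def l_def \<kappa>_def \<rho>_def)
  qed
  have r_pos: "r i \<noteq> 0" if "i < m" for i
  proof -
    have "area2 a b (z (Up i)) < 0"
      using z that d1 d2 by (auto simp: area_ab necklace_def p_def q_def mult_less_0_iff)
    then have "z (Up i) \<noteq> a" "z (Up i) \<noteq> b" by (auto simp: area2_def algebra_simps)
    moreover have "inner (z (Up i)) (z (Up i)) = 1" using circ that by (auto simp: dot_square_norm)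
    ultimately have "inner (z (Up i)) a < 1" "inner (z (Up i)) b < 1"
      using inner_less_1_circle ab by auto
    then show ?thesis by (simp add: r_def \<rho>_def)
  qed
  have e1: "r i * l i = \<kappa> i" if "i < m" for i
    using incid[of i i i] z that by (simp add: necklace_def)
  have e2: "r (Suc i) * l i = \<kappa> (pr m i)" if "Suc i < m" for i
    using incid[of "Suc i" i "pr m i"] z that by (auto simp: necklace_def pr_def split: if_splits)
  \<comment> \<open>The product \<open>r i * \<kappa> (pr m i)\<close> is constant along the cycle:
    \<open>e1\<close> and \<open>e2\<close> at \<open>i\<close> share the factor
    \<open>l i\<close>.\<close>
  have tele: "i < m \<Longrightarrow> r i * \<kappa> (pr m i) = r 0 * \<kappa> (m - 1)" for i
  proof (induction i)
    case 0
    then show ?case by (simp add: pr_def)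
  next
    case (Suc i)
    have "r (Suc i) * \<kappa> (pr m (Suc i)) = r (Suc i) * (r i * l i)"
      using e1[of i] Suc.prems by (simp add: pr_def)
    also have "\<dots> = r i * \<kappa> (pr m i)" using e2[OF Suc.prems] by (simp add: ac_simps)
    also have "\<dots> = r 0 * \<kappa> (m - 1)" using Suc by simp
    finally show ?case .
  qed
  \<comment> \<open>At the last index, \<open>\<kappa> (m - 1)\<close> splits by \<open>e1\<close>,
    and cancelling \<open>r (m - 1)\<close> leaves the closing equation.\<close>
  have "r (m - 1) * \<kappa> (m - 2) = r (m - 1) * (r 0 * l (m - 1))"
    using tele[of "m - 1"] e1[of "m - 1"] m by (simp add: pr_def numeral_2_eq_2 ac_simps)
  then have "r 0 * l (m - 1) = \<kappa> (m - 2)" using r_pos[of "m - 1"] m by simp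
  then show False using incid[of 0 "m - 1" "m - 2"] z m by (simp add: necklace_def)
qed


text \<open>A nonzero area keeps its sign in the limit process by continuity, uniformly over
  finitely many triples. Collinear triples are not controlled and have to be treated by
  hand.\<close>

lemma eventually_same_orientation:
  assumes "finite I" and lim: "\<And>i. i \<in> I \<Longrightarrow> ((\<lambda>e. z e i) \<longlongrightarrow> Q i) F"
  shows "eventually (\<lambda>e. \<forall>i\<in>I. \<forall>j\<in>I. \<forall>k\<in>I. orientation (Q i) (Q j) (Q k) \<noteq> 0 \<longrightarrow>
    orientation (z e i) (z e j) (z e k) = orientation (Q i) (Q j) (Q k)) F"
proof (intro eventually_ball_finite ballI \<open>finite I\<close>)
  fix i j k assume "i \<in> I" "j \<in> I" "k \<in> I"
  then have lim3: "((\<lambda>e. area2 (z e i) (z e j) (z e k)) \<longlongrightarrow> area2 (Q i) (Q j) (Q k)) F"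
    unfolding area2_def by (intro tendsto_intros lim)
  consider "area2 (Q i) (Q j) (Q k) = 0" | "area2 (Q i) (Q j) (Q k) > 0" | "area2 (Q i) (Q j) (Q k) < 0"
    by linarith
  then show "eventually (\<lambda>e. orientation (Q i) (Q j) (Q k) \<noteq> 0 \<longrightarrow>
    orientation (z e i) (z e j) (z e k) = orientation (Q i) (Q j) (Q k)) F"
  proof cases
    case 1
    then show ?thesis by (simp add: orientation_eq)
  next
    case 2
    show ?thesis
      using order_tendstoD(1)[OF lim3 2] by eventually_elim (use 2 in \<open>simp add: orientation_eq\<close>)
  next
    case 3
    show ?thesis
      using order_tendstoD(2)[OF lim3 3] by eventually_elim (use 3 in \<open>simp add: orientation_eq\<close>)
  qed
qed

section \<open>The inscribed model\<close>

text \<open>\<open>circ t\<close> has angle \<open>2 * arctan t\<close>, so the chord from \<open>circ r\<close> to \<open>circ (- s)\<close> meets the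
  horizontal axis in \<open>mid (r * s)\<close>.\<close>

definition circ :: "real \<Rightarrow> real^2" where
  "circ t = (\<chi> i. if i = 1 then (1 - t\<^sup>2) / (1 + t\<^sup>2) else 2 * t / (1 + t\<^sup>2))"

definition mid :: "real \<Rightarrow> real^2" where
  "mid d = (\<chi> i. if i = 1 then (1 - d) / (1 + d) else 0)"

section \<open>Orientations in the rational parametrization of the circle\<close>

lemma circ_nth [simp]: "circ t $ 1 = (1 - t\<^sup>2) / (1 + t\<^sup>2)" "circ t $ 2 = 2 * t / (1 + t\<^sup>2)"
  by (simp_all add: circ_def)

lemma mid_nth [simp]: "mid d $ 1 = (1 - d) / (1 + d)" "mid d $ 2 = 0"
  by (simp_all add: mid_def)

lemma one_plus_square_pos: "1 + (t::real)\<^sup>2 > 0"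
  by (simp add: add_pos_nonneg)

lemma norm_circ: "norm (circ t) = 1"
proof -
  have "(1 - t\<^sup>2)\<^sup>2 + (2 * t)\<^sup>2 = (1 + t\<^sup>2)\<^sup>2" by algebra
  then have "inner (circ t) (circ t) = 1"
    using one_plus_square_pos[of t]
    by (simp add: inner_real2 power2_eq_square[symmetric] power_divide add_divide_distrib[symmetric])
  then show ?thesis by (simp add: norm_eq_1)
qed

lemma norm_mid:
  assumes "d > 0"
  shows "norm (mid d) \<le> 1"
proof -
  have "\<bar>1 - d\<bar> \<le> \<bar>1 + d\<bar>" using assms by linarith
  then have "\<bar>(1 - d) / (1 + d)\<bar> \<le> 1" using assms by (simp add: abs_divide)
  then have "inner (mid d) (mid d) \<le> 1"
    by (simp add: inner_real2 abs_square_le_1 power2_eq_square[symmetric])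
  then show ?thesis by (simp add: dot_square_norm abs_square_le_1)
qed

lemma tendsto_circ: "(g \<longlongrightarrow> t) F \<Longrightarrow> ((\<lambda>e. circ (g e)) \<longlongrightarrow> circ t) F"
  using one_plus_square_pos[of t]
  by (intro vec_tendstoI) (auto simp: circ_def intro!: tendsto_eq_intros)

text \<open>Shaped for areas with cleared denominators: \<open>c\<close> is the product of the
  positive denominators, and 4 comes from the numerators.\<close>

lemma sgn_eq_if_scaled: "(x::real) * c = y * 4 \<Longrightarrow> c > 0 \<Longrightarrow> sgn x = sgn y"
  by (metis mult.commute mult_less_0_iff mult_pos_pos sgn_mult sgn_pos zero_less_numeral mult_1)

text \<open>A Vandermonde determinant: increasing parameters run counterclockwise around the
  circle.\<close>

lemma orientation_circ_circ_circ:
  "orientation (circ r) (circ s) (circ t) = sgn ((s - r) * (t - s) * (t - r))"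
proof -
  have "area2 (circ r) (circ s) (circ t) * ((1 + r\<^sup>2) * (1 + s\<^sup>2) * (1 + t\<^sup>2))
      = ((s - r) * (t - s) * (t - r)) * 4"
  proof -
    \<comment> \<open>With the points opaque, the coordinates are variables subject to polynomial
      equations, which can be eliminated without division.\<close>
    define R S T where "R = circ r" and "S = circ s" and "T = circ t"
    have "R$1 * (1 + r\<^sup>2) = 1 - r\<^sup>2" "R$2 * (1 + r\<^sup>2) = 2 * r" "S$1 * (1 + s\<^sup>2) = 1 - s\<^sup>2"
      "S$2 * (1 + s\<^sup>2) = 2 * s" "T$1 * (1 + t\<^sup>2) = 1 - t\<^sup>2" "T$2 * (1 + t\<^sup>2) = 2 * t"
      using one_plus_square_pos[of r] one_plus_square_pos[of s] one_plus_square_pos[of t]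
      by (simp_all add: R_def S_def T_def)
    then show ?thesis unfolding area2_def R_def[symmetric] S_def[symmetric] T_def[symmetric]
      by algebra
  qed
  then show ?thesis unfolding orientation_eq
    by (rule sgn_eq_if_scaled) (simp add: one_plus_square_pos)
qed

lemma orientation_circ_circ_mid:
  assumes "d > 0"
  shows "orientation (circ r) (circ s) (mid d) = sgn ((s - r) * (d + r * s))"
proof -
  have "area2 (circ r) (circ s) (mid d) * ((1 + r\<^sup>2) * (1 + s\<^sup>2) * (1 + d))
      = ((s - r) * (d + r * s)) * 4"
  proof -
    define R S T where "R = circ r" and "S = circ s" and "T = mid d"
    have "R$1 * (1 + r\<^sup>2) = 1 - r\<^sup>2" "R$2 * (1 + r\<^sup>2) = 2 * r" "S$1 * (1 + s\<^sup>2) = 1 - s\<^sup>2"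
      "S$2 * (1 + s\<^sup>2) = 2 * s" "T$1 * (1 + d) = 1 - d" "T$2 = 0"
      using one_plus_square_pos[of r] one_plus_square_pos[of s] assms
      by (simp_all add: R_def S_def T_def)
    then show ?thesis unfolding area2_def R_def[symmetric] S_def[symmetric] T_def[symmetric]
      by algebra
  qed
  then show ?thesis unfolding orientation_eq
    by (rule sgn_eq_if_scaled) (use assms in \<open>simp add: one_plus_square_pos\<close>)
qed

lemma orientation_mid_mid_circ:
  assumes "c > 0" "d > 0"
  shows "orientation (mid c) (mid d) (circ t) = sgn (t * (c - d))"
proof -
  have "area2 (mid c) (mid d) (circ t) * ((1 + c) * (1 + d) * (1 + t\<^sup>2)) = (t * (c - d)) * 4"
  proof -
    define R S T where "R = mid c" and "S = mid d" and "T = circ t"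
    have "R$1 * (1 + c) = 1 - c" "R$2 = 0" "S$1 * (1 + d) = 1 - d"
      "S$2 = 0" "T$1 * (1 + t\<^sup>2) = 1 - t\<^sup>2" "T$2 * (1 + t\<^sup>2) = 2 * t"
      using one_plus_square_pos[of t] assms by (simp_all add: R_def S_def T_def)
    then show ?thesis unfolding area2_def R_def[symmetric] S_def[symmetric] T_def[symmetric]
      by algebra
  qed
  then show ?thesis unfolding orientation_eq
    by (rule sgn_eq_if_scaled) (use assms in \<open>simp add: one_plus_square_pos\<close>)
qed

lemma orientation_mid_mid_mid: "orientation (mid c) (mid d) (mid e) = 0"
  by (simp add: orientation_def)

text \<open>The double exponential makes every product of two of these numbers determine its factors,
  which excludes accidental incidences. The values \<open>upar\<close> and \<open>lpar\<close> solve the equations of the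
  cycle.\<close>

definition mpar :: "nat \<Rightarrow> real" where
  "mpar k = 2 ^ (3 ^ k)"

definition upar :: "nat \<Rightarrow> nat \<Rightarrow> real" where
  "upar m i = 1 / mpar (pr m i)"

definition lpar :: "nat \<Rightarrow> nat \<Rightarrow> real" where
  "lpar m i = mpar i * mpar (pr m i)"

section \<open>Arithmetic of the double exponential parameters\<close>

lemma mpar_pos [simp]: "mpar k > 0" and upar_pos [simp]: "upar m i > 0"
  and lpar_pos [simp]: "lpar m i > 0"
  by (simp_all add: mpar_def upar_def lpar_def)

lemma mpar_neq_0: "mpar k \<noteq> 0"
  by (simp add: mpar_def)

lemma mpar_less_iff [simp]: "mpar j < mpar k \<longleftrightarrow> j < k"
  by (simp add: mpar_def)

lemma mpar_eq_iff [simp]: "mpar j = mpar k \<longleftrightarrow> j = k"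
  by (simp add: mpar_def)

text \<open>The right side is at most \<open>2 * 3 ^ d\<close>, which is less than
  \<open>3 ^ Suc d\<close>.\<close>

lemma sum_power3_max_le:
  assumes "(3::nat) ^ a + 3 ^ b = 3 ^ c + 3 ^ d" "c \<le> d"
  shows "a \<le> d"
proof (rule ccontr)
  assume "\<not> a \<le> d"
  then have "(3::nat) ^ Suc d \<le> 3 ^ a" by (intro power_increasing) auto
  moreover have "(3::nat) ^ c \<le> 3 ^ d" using assms(2) by (intro power_increasing) auto
  moreover have "(3::nat) ^ d > 0" "(3::nat) ^ b > 0" by simp_all
  ultimately show False using assms(1) by simp
qed

text \<open>The bound used in both directions makes the larger exponents equal; cancelling that
  power settles the other one.\<close>

lemma sum_power3_eq:
  assumes "(3::nat) ^ a + 3 ^ b = 3 ^ c + 3 ^ d"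
  shows "a = c \<and> b = d \<or> a = d \<and> b = c"
proof -
  have "max a b \<le> max c d"
    using assms sum_power3_max_le[of a b c d] sum_power3_max_le[of a b d c]
      sum_power3_max_le[of b a c d] sum_power3_max_le[of b a d c]
    by (cases "c \<le> d") (auto simp: add.commute)
  moreover have "max c d \<le> max a b"
    using assms sum_power3_max_le[of c d a b] sum_power3_max_le[of c d b a]
      sum_power3_max_le[of d c a b] sum_power3_max_le[of d c b a]
    by (cases "a \<le> b") (auto simp: add.commute)
  ultimately have "max a b = max c d" by (rule antisym)
  then have "a = c \<or> a = d \<or> b = c \<or> b = d" by (auto simp: max_def split: if_splits)
  then show ?thesis using assms by auto
qed

lemma mpar_mult_eq_iff:
  "mpar a * mpar b = mpar c * mpar d \<longleftrightarrow> a = c \<and> b = d \<or> a = d \<and> b = c"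
  using sum_power3_eq[of a b c d] by (auto simp: mpar_def power_add[symmetric] add.commute)

lemma pr_inj: "i < m \<Longrightarrow> j < m \<Longrightarrow> pr m i = pr m j \<longleftrightarrow> i = j"
  by (auto simp: pr_def split: if_splits)

lemma pr_surj: "k < m \<Longrightarrow> \<exists>j<m. pr m j = k"
  by (cases "Suc k = m") (auto simp: pr_def intro: exI[of _ 0] exI[of _ "Suc k"])

lemma upar_eq_iff: "i < m \<Longrightarrow> j < m \<Longrightarrow> upar m i = upar m j \<longleftrightarrow> i = j"
  by (simp add: upar_def pr_inj)

text \<open>The pairs of an index and its predecessor are distinct as sets only from
  \<open>m = 3\<close> on; for \<open>m = 2\<close> the two products coincide.\<close>

lemma lpar_eq_iff: "m \<ge> 3 \<Longrightarrow> i < m \<Longrightarrow> j < m \<Longrightarrow> lpar m i = lpar m j \<longleftrightarrow> i = j"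
  by (auto simp: lpar_def mpar_mult_eq_iff pr_def split: if_splits)

text \<open>Cleared of its denominator, the equation compares two products of two values of
  \<open>mpar\<close>, so the factors agree up to order. The alternatives are the two families of
  chords of the cycle; no further incidence arises.\<close>

lemma upar_lpar_eq_iff:
  assumes "m \<ge> 3" "i < m" "j < m" "k < m"
  shows "upar m i * lpar m j = mpar k \<longleftrightarrow> i = j \<and> j = k \<or> j = pr m i \<and> k = pr m j"
proof -
  have "upar m i * lpar m j = mpar k \<longleftrightarrow> mpar j * mpar (pr m j) = mpar k * mpar (pr m i)"
    by (simp add: upar_def lpar_def divide_eq_eq mpar_neq_0)
  then show ?thesis using assms by (auto simp: mpar_mult_eq_iff pr_inj)
qed

text \<open>Through \<open>Mid k\<close> go the chords with upper ends \<open>k\<close> and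
  \<open>k + 2\<close> modulo \<open>m\<close>, which differ since \<open>m >= 3\<close>. This keeps
  every \<open>Mid k\<close> off the edges of the hull.\<close>

lemma other_chord:
  assumes "m \<ge> 3" "k < m" "i < m"
  shows "\<exists>i'<m. \<exists>j'<m. i' \<noteq> i \<and> upar m i' * lpar m j' = mpar k"
proof (cases "i = k")
  case False
  then show ?thesis using assms by (auto intro!: exI[of _ k] simp: upar_lpar_eq_iff)
next
  case True
  obtain j' where j': "j' < m" "pr m j' = k" using assms pr_surj by blast
  obtain i' where i': "i' < m" "pr m i' = j'" using j' pr_surj by blast
  have "i' \<noteq> k" using assms j' i' by (auto simp: pr_def split: if_splits)
  moreover have "upar m i' * lpar m j' = mpar k"
    using assms i' j' by (simp add: upar_lpar_eq_iff)
  ultimately show ?thesis using True i'(1) j'(1) by blast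
qed

fun par :: "nat \<Rightarrow> idx \<Rightarrow> real" where
  "par m (Up i) = upar m i"
| "par m (Low i) = - lpar m i"
| "par m (Mid i) = mpar i"

text \<open>Scaling upper parameters by \<open>\<tau>\<close> and lower ones by its inverse
  preserves the product along a chord whose ends both move or both stay. Only chords between the
  moved and the fixed part are broken.\<close>

fun conf :: "nat \<Rightarrow> nat \<Rightarrow> nat \<Rightarrow> real \<Rightarrow> idx \<Rightarrow> real^2" where
  "conf m a b \<tau> (Up i) = circ (if i < a then \<tau> * upar m i else upar m i)"
| "conf m a b \<tau> (Low i) = circ (- (if i < b then lpar m i / \<tau> else lpar m i))"
| "conf m a b \<tau> (Mid i) = mid (mpar i)"

definition base :: "nat \<Rightarrow> idx \<Rightarrow> real^2" where
  "base m = conf m 0 0 1"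

section \<open>Collinear triples of the model\<close>

lemma base_Mid [simp]: "base m (Mid k) = mid (mpar k)"
  by (simp add: base_def)

lemma base_vert: "v \<in> verts m \<Longrightarrow> base m v = circ (par m v)"
  by (cases v) (auto simp: base_def)

lemma par_inj:
  assumes "m \<ge> 3" "v \<in> verts m" "w \<in> verts m" "par m v = par m w"
  shows "v = w"
proof -
  have "upar m i \<noteq> - lpar m j" "- lpar m j \<noteq> upar m i" for i j
    using upar_pos[of m i] lpar_pos[of m j] by linarith+
  then show ?thesis using assms by (cases v; cases w) (auto simp: upar_eq_iff lpar_eq_iff)
qed

text \<open>A negative product of parameters needs one vertex on each of the two arcs.\<close>

lemma par_mult_eq:
  assumes "v \<in> verts m" "w \<in> verts m" "mpar k + par m v * par m w = 0"
  shows "\<exists>i<m. \<exists>j<m. {v, w} = {Up i, Low j} \<and> upar m i * lpar m j = mpar k"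
proof -
  have *: "mpar k + upar m i * upar m j > 0" "mpar k + lpar m i * lpar m j > 0" for i j
    by (simp_all add: add_pos_pos)
  consider i j where "v = Up i" "w = Low j" | i j where "v = Low j" "w = Up i"
    | i j where "v = Up i" "w = Up j" | i j where "v = Low i" "w = Low j"
    using assms(1,2) by (cases v; cases w) auto
  then show ?thesis
  proof cases
    case 1
    then show ?thesis using assms by (intro exI[of _ i] conjI exI[of _ j]) auto
  next
    case 2
    then show ?thesis
      using assms by (intro exI[of _ i] conjI exI[of _ j]) (auto simp: mult.commute)
  next
    case 3
    then show ?thesis using assms(3) *(1)[of i j] by simp
  next
    case 4
    then show ?thesis using assms(3) *(2)[of i j] by simp
  qed
qed


lemma par_neq_0: "v \<in> verts m \<Longrightarrow> par m v \<noteq> 0"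
proof (cases v)
  case (Up i)
  then show ?thesis by (simp add: upar_def mpar_neq_0)
next
  case (Low i)
  then show ?thesis by (simp add: lpar_def mpar_neq_0)
qed simp

lemma inds_cases:
  assumes "v \<in> inds m"
  obtains "v \<in> verts m" | a where "v = Mid a" "a < m"
  using assms by (auto simp: inds_def)

text \<open>Three points of a circle are never collinear, and no vertex lies on the axis. What
  remains is the axis itself and a chord through a \<open>Mid\<close>, which
  \<open>par_mult_eq\<close> identifies.\<close>

lemma base_orientation_zero:
  assumes m: "m \<ge> 3" and ijk: "i \<in> inds m" "j \<in> inds m" "k \<in> inds m"
    and zero: "orientation (base m i) (base m j) (base m k) = 0"
    and distinct: "i \<noteq> j" "j \<noteq> k" "i \<noteq> k"
  shows "(\<exists>a b c. {i, j, k} = {Mid a, Mid b, Mid c}) \<or>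
    (\<exists>a<m. \<exists>b<m. \<exists>c<m. {i, j, k} = {Up a, Low b, Mid c} \<and> upar m a * lpar m b = mpar c)"
proof -
  have chord: ?thesis
    if vw: "v \<in> verts m" "w \<in> verts m" "c < m" "v \<noteq> w" and eq: "{i, j, k} = {v, w, Mid c}"
      and o: "orientation (base m v) (base m w) (base m (Mid c)) = 0" for v w c
  proof -
    have "par m w \<noteq> par m v" using par_inj[OF m] vw by metis
    then have "mpar c + par m v * par m w = 0"
      using o vw by (simp add: base_vert orientation_circ_circ_mid sgn_zero_iff)
    then obtain a b where ab: "a < m" "b < m" "{v, w} = {Up a, Low b}" "upar m a * lpar m b = mpar c"
      using par_mult_eq[OF vw(1,2)] by metis
    have "{i, j, k} = insert (Mid c) {v, w}" unfolding eq by (simp add: insert_commute)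
    also have "\<dots> = {Up a, Low b, Mid c}" unfolding ab(3) by (simp add: insert_commute)
    finally show ?thesis using ab vw(3) by metis
  qed
  have mids: False
    if "v \<in> verts m" "b \<noteq> c"
      "orientation (base m (Mid b)) (base m (Mid c)) (base m v) = 0" for v b c
    using that par_neq_0[of v m] by (simp add: base_vert orientation_mid_mid_circ sgn_zero_iff)
  \<comment> \<open>Rotating a mixed triple brings the label of the minority kind to the last place,
    where \<open>chord\<close> and \<open>mids\<close> expect it.\<close>
  have zero': "orientation (base m j) (base m k) (base m i) = 0"
    "orientation (base m k) (base m i) (base m j) = 0"
    using zero orientation_rotate by metis+
  consider "i \<in> verts m" "j \<in> verts m" "k \<in> verts m"
    | c where "i \<in> verts m" "j \<in> verts m" "k = Mid c" "c < m"
    | c where "j \<in> verts m" "k \<in> verts m" "i = Mid c" "c < m"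
    | c where "k \<in> verts m" "i \<in> verts m" "j = Mid c" "c < m"
    | b c where "i \<in> verts m" "j = Mid b" "b < m" "k = Mid c" "c < m"
    | b c where "j \<in> verts m" "k = Mid b" "b < m" "i = Mid c" "c < m"
    | b c where "k \<in> verts m" "i = Mid b" "b < m" "j = Mid c" "c < m"
    | a b c where "i = Mid a" "j = Mid b" "k = Mid c"
    using inds_cases[OF ijk(1)] inds_cases[OF ijk(2)] inds_cases[OF ijk(3)] by metis
  then show ?thesis
  proof cases
    case 1
    then have "par m j \<noteq> par m i" "par m k \<noteq> par m j" "par m k \<noteq> par m i"
      using par_inj[OF m] distinct by metis+
    then show ?thesis
      using zero 1 by (simp add: base_vert orientation_circ_circ_circ sgn_zero_iff)
  next
    case 2
    then show ?thesis using chord[of i j c] zero distinct by simp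
  next
    case 3
    then show ?thesis using chord[of j k c] zero' distinct by (simp add: insert_commute)
  next
    case 4
    then show ?thesis using chord[of k i c] zero' distinct by (simp add: insert_commute)
  next
    case 5
    then show ?thesis using mids[of i b c] zero' distinct by auto
  next
    case 6
    then show ?thesis using mids[of j b c] zero' distinct by auto
  next
    case 7
    then show ?thesis using mids[of k b c] zero distinct by auto
  next
    case 8
    then show ?thesis by blast
  qed
qed

text \<open>The order type of a small perturbation of \<open>base m\<close> that breaks exactly the closing incidence
  of the cycle, restricted to the points with labels in \<open>J\<close>.\<close>

definition realizes :: "nat \<Rightarrow> idx set \<Rightarrow> (idx \<Rightarrow> real^2) \<Rightarrow> bool" where
  "realizes m J z \<longleftrightarrow>
     (\<forall>i\<in>J. \<forall>j\<in>J. \<forall>k\<in>J. orientation (base m i) (base m j) (base m k) \<noteq> 0 \<longrightarrow>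
        orientation (z i) (z j) (z k) = orientation (base m i) (base m j) (base m k)) \<and>
     (\<forall>a b c. Mid a \<in> J \<longrightarrow> Mid b \<in> J \<longrightarrow> Mid c \<in> J \<longrightarrow>
        orientation (z (Mid a)) (z (Mid b)) (z (Mid c)) = 0) \<and>
     (\<forall>a b c. Up a \<in> J \<longrightarrow> Low b \<in> J \<longrightarrow> Mid c \<in> J \<longrightarrow> upar m a * lpar m b = mpar c \<longrightarrow>
        orientation (z (Up a)) (z (Low b)) (z (Mid c)) =
          (if a = 0 \<and> b = m - 1 \<and> c = m - 2 then 1 else 0))"

section \<open>Families of points with the perturbed order type\<close>

lemma realizes_generic:
  assumes "realizes m J z" "i \<in> J" "j \<in> J" "k \<in> J"
    and "orientation (base m i) (base m j) (base m k) \<noteq> 0"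
  shows "orientation (z i) (z j) (z k) = orientation (base m i) (base m j) (base m k)"
  using assms unfolding realizes_def by blast

lemma realizes_subset: "realizes m J z \<Longrightarrow> K \<subseteq> J \<Longrightarrow> realizes m K z"
  unfolding realizes_def by (meson subsetD)

text \<open>Both orientations change by the sign of the same permutation. Needed because
  \<open>base_orientation_zero\<close> describes collinear triples only as unordered sets.\<close>

lemma orientation_eq_permute:
  assumes "orientation (z a) (z b) (z c) = orientation (w a) (w b) (w c)"
    and "{i, j, k} = {a, b, c}" "i \<noteq> j" "j \<noteq> k" "i \<noteq> k"
  shows "orientation (z i) (z j) (z k) = orientation (w i) (w j) (w k)"
proof -
  have perms: "orientation (u b) (u c) (u a) = orientation (u a) (u b) (u c)"
    "orientation (u c) (u a) (u b) = orientation (u a) (u b) (u c)"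
    "orientation (u b) (u a) (u c) = - orientation (u a) (u b) (u c)"
    "orientation (u a) (u c) (u b) = - orientation (u a) (u b) (u c)"
    "orientation (u c) (u b) (u a) = - orientation (u a) (u b) (u c)" for u :: "'a \<Rightarrow> real^2"
    using orientation_rotate orientation_swap by metis+
  have "i \<in> {a, b, c}" "j \<in> {a, b, c}" "k \<in> {a, b, c}" using assms(2) by blast+
  then consider "i = a" "j = b" "k = c" | "i = a" "j = c" "k = b" | "i = b" "j = a" "k = c"
    | "i = b" "j = c" "k = a" | "i = c" "j = a" "k = b" | "i = c" "j = b" "k = a"
    using assms(3-5) by blast
  then show ?thesis by cases (simp_all add: assms(1) perms)
qed

text \<open>By \<open>base_orientation_zero\<close> each triple of distinct labels is either generic
  or listed in \<open>realizes\<close>, so that predicate fixes the whole order type.\<close>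

lemma realizes_same_orientation:
  assumes m: "m \<ge> 3" and J: "J \<subseteq> inds m" and z: "realizes m J z" and w: "realizes m J w"
    and ijk: "i \<in> J" "j \<in> J" "k \<in> J"
  shows "orientation (z i) (z j) (z k) = orientation (w i) (w j) (w k)"
proof (cases "i = j \<or> j = k \<or> i = k")
  case True
  then show ?thesis by (auto simp: orientation_def)
next
  case dist: False
  show ?thesis
  proof (cases "orientation (base m i) (base m j) (base m k) = 0")
    case False
    then show ?thesis using z w ijk unfolding realizes_def by metis
  next
    case True
    have "i \<in> inds m" "j \<in> inds m" "k \<in> inds m" using J ijk by auto
    then have "(\<exists>a b c. {i, j, k} = {Mid a, Mid b, Mid c}) \<or>
      (\<exists>a<m. \<exists>b<m. \<exists>c<m. {i, j, k} = {Up a, Low b, Mid c} \<and> upar m a * lpar m b = mpar c)"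
      using base_orientation_zero[OF m _ _ _ True] dist by simp
    then show ?thesis
    proof (elim disjE exE conjE)
      fix a b c assume eq: "{i, j, k} = {Mid a, Mid b, Mid c}"
      have "{Mid a, Mid b, Mid c} \<subseteq> J" unfolding eq[symmetric] using ijk by simp
      then have "orientation (z (Mid a)) (z (Mid b)) (z (Mid c)) =
          orientation (w (Mid a)) (w (Mid b)) (w (Mid c))"
        using z w unfolding realizes_def by simp
      then show ?thesis using eq by (rule orientation_eq_permute) (use dist in simp_all)
    next
      fix a b c assume eq: "{i, j, k} = {Up a, Low b, Mid c}" and prod: "upar m a * lpar m b = mpar c"
      have "{Up a, Low b, Mid c} \<subseteq> J" unfolding eq[symmetric] using ijk by simp
      then have "orientation (z (Up a)) (z (Low b)) (z (Mid c)) =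
          orientation (w (Up a)) (w (Low b)) (w (Mid c))"
        using z w prod unfolding realizes_def by simp
      then show ?thesis using eq by (rule orientation_eq_permute) (use dist in simp_all)
    qed
  qed
qed

lemma realizes_transfer:
  assumes "realizes m J z"
    and "\<And>i j k. i \<in> J \<Longrightarrow> j \<in> J \<Longrightarrow> k \<in> J \<Longrightarrow>
      orientation (w i) (w j) (w k) = orientation (z i) (z j) (z k)"
  shows "realizes m J w"
  using assms unfolding realizes_def by simp

text \<open>Coinciding points would be collinear with every third point, but each pair of labels has
  a third label in \<open>J\<close> that is not collinear with it in \<open>base m\<close>.\<close>

lemma realizes_inj:
  assumes m: "m \<ge> 3" and J: "J \<subseteq> inds m" "inds m - {v} \<subseteq> J" "v \<in> verts m" and z: "realizes m J z"
  shows "inj_on z J"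
proof (rule inj_onI, rule ccontr)
  fix i j assume ij: "i \<in> J" "j \<in> J" "z i = z j" "i \<noteq> j"
  have "\<exists>k\<in>J. k \<noteq> i \<and> k \<noteq> j \<and> orientation (base m i) (base m j) (base m k) \<noteq> 0"
  proof -
    \<comment> \<open>At least six vertices exist, so one avoids \<open>v\<close>, \<open>i\<close>
      and \<open>j\<close>.\<close>
    have "card {v, i, j} \<le> 3" by (simp add: card_insert_if)
    then have "card (verts m) > card {v, i, j}" using m by (simp add: card_verts)
    then have "\<not> verts m \<subseteq> {v, i, j}" using card_mono by (metis finite.intros linorder_not_le)
    then obtain k where k: "k \<in> J" "k \<noteq> i" "k \<noteq> j" "k \<in> verts m"
      using J verts_subset_inds by blast
    have generic: "orientation (base m i) (base m j) (base m l) \<noteq> 0"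
      if l: "l \<in> J" "l \<noteq> i" "l \<noteq> j"
        and nmid: "\<And>a b c. {i, j, l} \<noteq> {Mid a, Mid b, Mid c}"
        and nchord: "\<And>a b c. {i, j, l} \<noteq> {Up a, Low b, Mid c}" for l
    proof
      assume zero: "orientation (base m i) (base m j) (base m l) = 0"
      have "i \<in> inds m" "j \<in> inds m" "l \<in> inds m" using ij l J by auto
      then show False using base_orientation_zero[OF m _ _ _ zero] l(2,3) ij(4) nmid nchord by metis
    qed
    have nmid: "{x, y, l} \<noteq> {Mid a, Mid b, Mid c}" if "l \<in> verts m" for x y l a b c
      using that by (cases l) auto
    have nchord: "{l, Mid x, Mid y} \<noteq> {Up a, Low b, Mid c}" for x y l a b c
      by (cases l) auto
    have "Mid x \<in> J" if "x < m" for x using that J by auto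
    then have M01: "Mid 0 \<in> J" "Mid 1 \<in> J" using m by auto
    consider "i \<in> verts m" "j \<in> verts m" | b where "i \<in> verts m" "j = Mid b"
      | a where "j \<in> verts m" "i = Mid a" | a b where "i = Mid a" "j = Mid b"
      using inds_cases ij J by (metis subsetD)
    then show ?thesis
    proof cases
      case 1
      then have "{i, j, k} \<noteq> {Up a, Low b, Mid c}" for a b c using k(4) by auto
      then show ?thesis using k nmid[OF k(4)] by (intro bexI[of _ k] conjI generic)
    next
      case 2
      \<comment> \<open>A third vertex could lie on a chord through \<open>i\<close> and
        \<open>j\<close>; a second point of the axis cannot.\<close>
      define l where "l = (if b = 0 then Mid 1 else Mid 0)"
      have "l \<in> J" "l \<noteq> i" "l \<noteq> j" using 2 M01 by (auto simp: l_def)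
      moreover have "{i, j, l} \<noteq> {Mid a, Mid b, Mid c}" for a b c
        using nmid[OF 2(1), of j l a b c] by (simp add: insert_commute)
      moreover have "{i, j, l} \<noteq> {Up a', Low b', Mid c'}" for a' b' c'
      proof -
        obtain y where "l = Mid y" by (cases "b = 0") (auto simp: l_def)
        then show ?thesis using nchord[of i b y a' b' c'] 2(2) by (simp add: insert_commute)
      qed
      ultimately show ?thesis by (intro bexI[of _ l] conjI generic)
    next
      case 3
      define l where "l = (if a = 0 then Mid 1 else Mid 0)"
      have "l \<in> J" "l \<noteq> i" "l \<noteq> j" using 3 M01 by (auto simp: l_def)
      moreover have "{i, j, l} \<noteq> {Mid a, Mid b, Mid c}" for a b c
        using nmid[OF 3(1), of i l a b c] by (simp add: insert_commute)
      moreover have "{i, j, l} \<noteq> {Up a', Low b', Mid c'}" for a' b' c'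
      proof -
        obtain y where "l = Mid y" by (cases "a = 0") (auto simp: l_def)
        then show ?thesis using nchord[of j a y a' b' c'] 3(2) by (simp add: insert_commute)
      qed
      ultimately show ?thesis by (intro bexI[of _ l] conjI generic)
    next
      case 4
      have "{i, j, k} \<noteq> {Up a', Low b', Mid c'}" for a' b' c'
        using nchord[of k a b a' b' c'] 4 by (simp add: insert_commute)
      then show ?thesis using k nmid[OF k(4)] by (intro bexI[of _ k] conjI generic)
    qed
  qed
  then obtain k where "k \<in> J" "orientation (base m i) (base m j) (base m k) \<noteq> 0" by blast
  moreover have "orientation (z i) (z j) (z k) = 0" using ij by (simp add: orientation_def)
  ultimately show False using z ij unfolding realizes_def by metis
qed


lemma realizes_necklace:
  assumes m: "m \<ge> 3" and z: "realizes m (inds m) z"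
  shows "necklace m z"
proof -
  have sgn0: "area2 p q r = 0 \<longleftrightarrow> orientation p q r = 0" for p q r
    by (simp add: orientation_eq sgn_zero_iff)
  have lt: "area2 p q r < 0 \<longleftrightarrow> orientation p q r = -1" and gt: "area2 p q r > 0 \<longleftrightarrow> orientation p q r = 1"
    for p q r by (auto simp: orientation_eq sgn_if)
  have generic: "orientation (z (Mid 0)) (z (Mid 1)) (z v) = - sgn (par m v)"
    if "v \<in> verts m" for v
  proof -
    \<comment> \<open>The axis is directed from \<open>Mid 0\<close> to \<open>Mid 1\<close>, that
      is to the left, so positive parameters lie on its negative side.\<close>
    have neg: "mpar 0 - mpar 1 < 0" by simp
    then have "par m v * (mpar 0 - mpar 1) \<noteq> 0" using par_neq_0[OF that] by simp
    then have "orientation (base m (Mid 0)) (base m (Mid 1)) (base m v) \<noteq> 0"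
      using that by (simp add: base_vert orientation_mid_mid_circ sgn_zero_iff)
    moreover have "Mid 0 \<in> inds m" "Mid 1 \<in> inds m" "v \<in> inds m"
      using m that verts_subset_inds by auto
    ultimately have "orientation (z (Mid 0)) (z (Mid 1)) (z v) =
      orientation (base m (Mid 0)) (base m (Mid 1)) (base m v)"
      using z unfolding realizes_def by blast
    also have "\<dots> = - sgn (par m v)"
      using that neg by (simp add: base_vert orientation_mid_mid_circ sgn_mult)
    finally show ?thesis .
  qed
  have chord: "orientation (z (Up i)) (z (Low j)) (z (Mid k)) =
      (if i = 0 \<and> j = m - 1 \<and> k = m - 2 then 1 else 0)"
    if "i < m" "j < m" "k < m" "upar m i * lpar m j = mpar k" for i j k
    using z that unfolding realizes_def by simp
  have pr: "pr m i < m" if "Suc i < m" for i using that by (auto simp: pr_def)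
  show ?thesis
    unfolding necklace_def sgn0 lt gt
  proof (intro conjI allI impI)
    fix k assume "k < m"
    then show "orientation (z (Mid 0)) (z (Mid 1)) (z (Mid k)) = 0"
      using z m unfolding realizes_def by simp
  next
    fix i assume "i < m"
    then show "orientation (z (Mid 0)) (z (Mid 1)) (z (Up i)) = -1"
      "orientation (z (Mid 0)) (z (Mid 1)) (z (Low i)) = 1"
      using generic[of "Up i"] generic[of "Low i"] by (simp_all add: sgn_minus)
  next
    fix i assume "i < m"
    then show "orientation (z (Up i)) (z (Low i)) (z (Mid i)) = 0"
      using chord[of i i i] m by (simp add: upar_lpar_eq_iff)
  next
    fix i assume "Suc i < m"
    then show "orientation (z (Up (Suc i))) (z (Low i)) (z (Mid (pr m i))) = 0"
      using chord[of "Suc i" i "pr m i"] m pr[of i] by (simp add: upar_lpar_eq_iff) (simp add: pr_def)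
  next
    show "orientation (z (Up 0)) (z (Low (m - 1))) (z (Mid (m - 2))) \<noteq> 0"
      using chord[of 0 "m - 1" "m - 2"] m by (simp add: upar_lpar_eq_iff) (simp add: pr_def numeral_2_eq_2)
  qed
qed

text \<open>Pushing \<open>Up 0\<close> away from \<open>Low 0\<close> keeps it on the chord through \<open>Mid 0\<close>.\<close>

lemma ex_realization:
  assumes m: "m \<ge> 3"
  shows "\<exists>z. realizes m (inds m) z"
proof -
  define x y where "x = base m (Up 0)" and "y = base m (Low 0)"
  define z where "z e i = (if i = Up 0 then x - e *\<^sub>R (y - x) else base m i)" for e i
  have "((\<lambda>e. z e i) \<longlongrightarrow> base m i) (at_right 0)" for i
  proof (cases "i = Up 0")
    case True
    have "((\<lambda>e. x - e *\<^sub>R (y - x)) \<longlongrightarrow> x - 0 *\<^sub>R (y - x)) (at_right 0)"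
      by (intro tendsto_intros)
    then show ?thesis by (simp add: z_def True x_def)
  qed (simp add: z_def)
  then have "eventually (\<lambda>e. \<forall>i\<in>inds m. \<forall>j\<in>inds m. \<forall>k\<in>inds m.
      orientation (base m i) (base m j) (base m k) \<noteq> 0 \<longrightarrow>
      orientation (z e i) (z e j) (z e k) = orientation (base m i) (base m j) (base m k)) (at_right 0)"
    by (intro eventually_same_orientation) auto
  then have "eventually (\<lambda>e. e > 0 \<and> (\<forall>i\<in>inds m. \<forall>j\<in>inds m. \<forall>k\<in>inds m.
      orientation (base m i) (base m j) (base m k) \<noteq> 0 \<longrightarrow>
      orientation (z e i) (z e j) (z e k) = orientation (base m i) (base m j) (base m k))) (at_right 0)"
    using eventually_at_right_less by (rule eventually_conj[rotated])
  then obtain e where e: "e > 0" and generic: "\<forall>i\<in>inds m. \<forall>j\<in>inds m. \<forall>k\<in>inds m.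
      orientation (base m i) (base m j) (base m k) \<noteq> 0 \<longrightarrow>
      orientation (z e i) (z e j) (z e k) = orientation (base m i) (base m j) (base m k)"
    using eventually_happens'[OF trivial_limit_at_right_real] by blast
  have move: "area2 (x - e *\<^sub>R (y - x)) q r = (1 + e) * area2 x q r - e * area2 y q r" for q r
    by (simp add: area2_def algebra_simps)
  have base0: "area2 (base m (Up a)) (base m (Low b)) (base m (Mid c)) = 0"
    if "upar m a * lpar m b = mpar c" for a b c
    using that orientation_circ_circ_mid[of "mpar c" "upar m a" "- lpar m b"]
    by (simp add: orientation_eq sgn_zero_iff base_def)
  have chord: "orientation (z e (Up a)) (z e (Low b)) (z e (Mid c)) =
      (if a = 0 \<and> b = m - 1 \<and> c = m - 2 then 1 else 0)"
    if abc: "a < m" "b < m" "c < m" "upar m a * lpar m b = mpar c" for a b c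
  proof (cases "a = 0")
    case False
    then show ?thesis using base0[OF abc(4)] by (simp add: z_def orientation_eq)
  next
    case True
    then have moved: "area2 (z e (Up a)) (z e (Low b)) (z e (Mid c)) =
        - e * area2 y (base m (Low b)) (base m (Mid c))"
      using base0[OF abc(4)] unfolding z_def by (simp add: move x_def[symmetric])
    \<comment> \<open>Two chords of the cycle end at \<open>Up 0\<close>: the one it slides along
      and the closing one.\<close>
    consider "b = 0" "c = 0" | "b = m - 1" "c = m - 2"
      using abc m True by (auto simp: upar_lpar_eq_iff pr_def numeral_2_eq_2)
    then show ?thesis
    proof cases
      case 1
      then show ?thesis
        using m moved by (simp add: orientation_eq y_def) (simp add: area2_def)
    next
      case 2
      \<comment> \<open>The order of \<open>Low 0\<close> and \<open>Low (m - 1)\<close> on the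
        circle decides to which side the closing chord moves, giving the sign 1 that
        \<open>realizes\<close> asks for.\<close>
      have "mpar 0 * mpar (m - 1) < mpar (m - 1) * mpar (m - 2)"
        using m by (simp add: mult.commute)
      then have less: "lpar m 0 < lpar m (m - 1)"
        using m by (simp add: lpar_def pr_def numeral_2_eq_2)
      have "(- lpar m (m - 1) - - lpar m 0) * (mpar c + (- lpar m 0) * (- lpar m (m - 1))) < 0"
        by (rule mult_neg_pos) (use less in \<open>simp_all add: add_pos_pos\<close>)
      then have "orientation y (base m (Low (m - 1))) (base m (Mid c)) = -1"
        using orientation_circ_circ_mid[of "mpar c" "- lpar m 0" "- lpar m (m - 1)"]
        by (simp add: y_def base_def)
      then have "area2 y (base m (Low (m - 1))) (base m (Mid c)) < 0"
        by (simp add: orientation_eq sgn_if split: if_splits)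
      then have "area2 (z e (Up a)) (z e (Low b)) (z e (Mid c)) > 0"
        using 2 e unfolding moved by (simp add: mult_pos_neg)
      then show ?thesis using True 2 by (simp add: orientation_eq)
    qed
  qed
  have "realizes m (inds m) (z e)"
    unfolding realizes_def using generic chord
    by (auto simp: z_def orientation_mid_mid_mid)
  then show ?thesis by blast
qed

text \<open>The parameters \<open>a\<close> and \<open>b\<close> of \<open>conf\<close> are chosen so that the part of the cycle from \<open>Up 0\<close> up to
  the deleted vertex is the part that moves.\<close>

lemma ex_inscribed_realization_delete:
  assumes m: "m \<ge> 3" and v: "v \<in> verts m"
  shows "\<exists>w. realizes m (inds m - {v}) w \<and> w ` inds m \<subseteq> cball 0 1 \<and> w ` verts m \<subseteq> sphere 0 1"
proof -
  \<comment> \<open>In the order \<open>Up 0\<close>, \<open>Low 0\<close>, \<open>Up 1\<close>,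
    \<open>Low 1\<close> and so on, the moved labels are exactly those before
    \<open>v\<close>.\<close>
  obtain a b where ab: "b < m" "v = Up b \<and> a = b \<or> v = Low b \<and> a = Suc b"
    using v by (cases v) auto
  have "((\<lambda>t. conf m a b t i) \<longlongrightarrow> base m i) (at_right 1)" for i
  proof (cases i)
    case (Up k)
    have "((\<lambda>t. t * upar m k) \<longlongrightarrow> upar m k) (at_right 1)"
      by (auto intro!: tendsto_eq_intros)
    then show ?thesis using Up by (cases "k < a") (auto simp: base_def intro!: tendsto_circ)
  next
    case (Low k)
    have "((\<lambda>t. - (lpar m k / t)) \<longlongrightarrow> - lpar m k) (at_right 1)"
      by (auto intro!: tendsto_eq_intros)
    then show ?thesis using Low by (cases "k < b") (auto simp: base_def intro!: tendsto_circ)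
  qed simp
  then have "eventually (\<lambda>t. \<forall>i\<in>inds m. \<forall>j\<in>inds m. \<forall>k\<in>inds m.
      orientation (base m i) (base m j) (base m k) \<noteq> 0 \<longrightarrow>
      orientation (conf m a b t i) (conf m a b t j) (conf m a b t k) =
        orientation (base m i) (base m j) (base m k)) (at_right 1)"
    by (intro eventually_same_orientation) auto
  then have "eventually (\<lambda>t. t > 1 \<and> (\<forall>i\<in>inds m. \<forall>j\<in>inds m. \<forall>k\<in>inds m.
      orientation (base m i) (base m j) (base m k) \<noteq> 0 \<longrightarrow>
      orientation (conf m a b t i) (conf m a b t j) (conf m a b t k) =
        orientation (base m i) (base m j) (base m k))) (at_right 1)"
    using eventually_at_right_less by (rule eventually_conj[rotated])
  then obtain t where t: "t > 1" and generic: "\<forall>i\<in>inds m. \<forall>j\<in>inds m. \<forall>k\<in>inds m.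
      orientation (base m i) (base m j) (base m k) \<noteq> 0 \<longrightarrow>
      orientation (conf m a b t i) (conf m a b t j) (conf m a b t k) =
        orientation (base m i) (base m j) (base m k)"
    using eventually_happens'[OF trivial_limit_at_right_real] by blast
  have chord: "orientation (conf m a b t (Up i)) (conf m a b t (Low j)) (conf m a b t (Mid k)) =
      (if i = 0 \<and> j = m - 1 \<and> k = m - 2 then 1 else 0)"
    if ijk: "i < m" "j < m" "k < m" "upar m i * lpar m j = mpar k" "Up i \<noteq> v" "Low j \<noteq> v" for i j k
  proof -
    define p q where "p = (if i < a then t * upar m i else upar m i)"
      and "q = (if j < b then lpar m j / t else lpar m j)"
    have pos: "p > 0" "q > 0" using t by (auto simp: p_def q_def)
    have o: "orientation (conf m a b t (Up i)) (conf m a b t (Low j)) (conf m a b t (Mid k)) =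
      sgn ((- q - p) * (mpar k - p * q))"
      using orientation_circ_circ_mid[of "mpar k" p "- q"] by (simp add: p_def q_def)
    show ?thesis
    proof (cases "i = 0 \<and> j = m - 1 \<and> k = m - 2")
      case True
      \<comment> \<open>Only the upper end of the closing chord moves, and \<open>t > 1\<close>
        gives the sign 1; hence the limit from the right.\<close>
      then have "p = t * upar m i" "q = lpar m j" using ab ijk by (auto simp: p_def q_def)
      then have "p * q = t * mpar k" using ijk(4) by (simp add: mult.assoc)
      then have "mpar k - p * q < 0" using t by simp
      then have "(- q - p) * (mpar k - p * q) > 0" using pos by (intro mult_neg_neg) auto
      then show ?thesis unfolding o using True by simp
    next
      case False
      \<comment> \<open>The remaining chords join neighbours in that order, and with
        \<open>v\<close> deleted none of them crosses from the moved to the fixed part.\<close>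
      have "i < a \<longleftrightarrow> j < b"
        using ab ijk False m by (auto simp: upar_lpar_eq_iff pr_def numeral_2_eq_2 split: if_splits)
      then have "p * q = mpar k" using ijk(4) t by (simp add: p_def q_def)
      then show ?thesis unfolding o using False by simp
    qed
  qed
  have "realizes m (inds m - {v}) (conf m a b t)"
    unfolding realizes_def using generic chord by (auto simp: orientation_mid_mid_mid simp del: conf.simps(1,2))
  moreover have "conf m a b t i \<in> sphere 0 1" if "i \<in> verts m" for i
    using that by (cases i) (simp_all add: norm_circ)
  moreover have "conf m a b t i \<in> cball 0 1" for i
    by (cases i) (simp_all add: norm_circ norm_mid)
  ultimately show ?thesis by blast
qed

section \<open>Extreme points and minimality\<close>

text \<open>The edge leads to the next parameter, or from the largest back to the smallest. A point
  \<open>Mid k\<close> lies strictly inside because one of its chords has an upper end different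
  from that of the edge.\<close>

lemma base_hull_edge:
  assumes m: "m \<ge> 3" and v: "v \<in> verts m"
  shows "\<exists>w\<in>verts m. w \<noteq> v \<and>
    (\<forall>p\<in>inds m - {v, w}. orientation (base m v) (base m w) (base m p) = 1)"
proof (cases "\<exists>u\<in>verts m. par m v < par m u")
  case True
  define U where "U = {u \<in> verts m. par m v < par m u}"
  define w where "w = arg_min_on (par m) U"
  have U: "finite U" "U \<noteq> {}" using True by (auto simp: U_def)
  have w: "w \<in> verts m" "par m v < par m w"
    using arg_min_if_finite(1)[OF U, of "par m"] by (auto simp: w_def U_def)
  have w_least: "par m w \<le> par m u" if "u \<in> verts m" "par m v < par m u" for u
    using arg_min_least[OF U, of u "par m"] that by (simp add: w_def U_def)
  have "orientation (base m v) (base m w) (base m p) = 1" if p: "p \<in> inds m - {v, w}" for p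
  proof (cases "p \<in> verts m")
    case True
    then have ne: "par m p \<noteq> par m v" "par m p \<noteq> par m w" using par_inj[OF m] v w p by auto
    then have "par m p < par m v \<or> par m w < par m p" using w_least[OF True] by linarith
    then have "(par m p - par m w) * (par m p - par m v) > 0"
      using w(2) by (auto simp: zero_less_mult_iff)
    then have "(par m w - par m v) * ((par m p - par m w) * (par m p - par m v)) > 0"
      using w(2) by simp
    then show ?thesis
      using True v w by (simp add: base_vert orientation_circ_circ_circ mult.assoc)
  next
    case False
    then obtain k where k: "p = Mid k" "k < m" using p by (auto simp: inds_def)
    have "mpar k + par m v * par m w > 0"
    proof (cases v)
      case (Up i)
      then have "par m v > 0" by simp
      moreover from this have "par m w > 0" using w(2) by linarith
      ultimately have "par m v * par m w > 0" by simp
      then show ?thesis using mpar_pos[of k] by linarith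
    next
      case (Low j)
      show ?thesis
      proof (cases w)
        case (Low j')
        then show ?thesis using \<open>v = Low j\<close> by (simp add: add_pos_pos)
      next
        case (Up i)
        have "i < m" using w Up by simp
        \<comment> \<open>Here \<open>v\<close> and \<open>w\<close> have the parameters nearest to
          0 on their arcs, so another chord through \<open>Mid k\<close> has a strictly larger
          product.\<close>
        then obtain i' j' where i'j': "i' < m" "j' < m" "i' \<noteq> i" "upar m i' * lpar m j' = mpar k"
          using other_chord[OF m k(2)] by metis
        have "par m v < upar m i'" using upar_pos[of m i'] lpar_pos[of m j] unfolding Low par.simps by linarith
        then have "upar m i \<le> upar m i'" using w_least[of "Up i'"] i'j' Up by simp
        then have "upar m i < upar m i'" using i'j' w Up upar_eq_iff[of i m i'] by auto
        moreover have "lpar m j \<le> lpar m j'"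
        proof (rule ccontr)
          assume "\<not> ?thesis"
          then have "upar m i \<le> - lpar m j'" using w_least[of "Low j'"] i'j' Up Low by simp
          then show False using upar_pos[of m i] lpar_pos[of m j'] by linarith
        qed
        ultimately have "upar m i * lpar m j < upar m i' * lpar m j'"
          by (intro mult_less_le_imp_less) (auto simp: less_imp_le)
        then show ?thesis using i'j' Up Low by (simp add: mult.commute)
      qed (use w in simp)
    qed (use v in simp)
    then have "(par m w - par m v) * (mpar k + par m v * par m w) > 0" using w by simp
    then show ?thesis using k v w by (simp add: base_vert orientation_circ_circ_mid)
  qed
  then show ?thesis using w by (intro bexI[of _ w]) auto
next
  case False
  \<comment> \<open>\<open>v\<close> has the largest parameter, so the hull closes up at the
    smallest one.\<close>
  define w where "w = arg_min_on (par m) (verts m)"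
  have V: "finite (verts m)" "verts m \<noteq> {}" using v by auto
  have w: "w \<in> verts m"
    using arg_min_if_finite(1)[OF V, of "par m"] by (auto simp: w_def)
  have w_least: "par m w \<le> par m u" if "u \<in> verts m" for u
    using arg_min_least[OF V that, of "par m"] by (simp add: w_def)
  have v_greatest: "par m u \<le> par m v" if "u \<in> verts m" for u using False that by force
  have "upar m 0 \<le> par m v" "par m w \<le> - lpar m 0"
    using v_greatest[of "Up 0"] w_least[of "Low 0"] m by simp_all
  then have signs: "0 < par m v" "par m w < 0" using upar_pos[of m 0] lpar_pos[of m 0] by linarith+
  obtain i where i: "v = Up i" "i < m"
  proof (cases v)
    case (Low j)
    then show ?thesis using signs(1) lpar_pos[of m j] unfolding Low par.simps by linarith
  qed (use v that in auto)
  obtain j where j: "w = Low j" "j < m"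
  proof (cases w)
    case (Up i)
    then show ?thesis using signs(2) upar_pos[of m i] unfolding Up par.simps by linarith
  qed (use w that in auto)
  have wv: "par m w < par m v" using signs by linarith
  have "orientation (base m v) (base m w) (base m p) = 1" if p: "p \<in> inds m - {v, w}" for p
  proof (cases "p \<in> verts m")
    case True
    then have "par m p \<noteq> par m v" "par m p \<noteq> par m w" using par_inj[OF m] v w p by auto
    then have "par m w < par m p" "par m p < par m v" using w_least[OF True] v_greatest[OF True] by auto
    then have "(par m w - par m v) * ((par m p - par m w) * (par m p - par m v)) > 0"
      using wv by (intro mult_neg_neg mult_pos_neg) auto
    then show ?thesis
      using True v w by (simp add: base_vert orientation_circ_circ_circ mult.assoc)
  next
    case False
    then obtain k where k: "p = Mid k" "k < m" using p by (auto simp: inds_def)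
    obtain i' j' where i'j': "i' < m" "j' < m" "i' \<noteq> i" "upar m i' * lpar m j' = mpar k"
      using other_chord[OF m k(2) i(2)] by metis
    have "upar m i' < upar m i"
      using v_greatest[of "Up i'"] i'j' i upar_eq_iff[of i m i'] by (auto simp: less_le)
    moreover have "lpar m j' \<le> lpar m j" using w_least[of "Low j'"] i'j' j by simp
    ultimately have "upar m i' * lpar m j' < upar m i * lpar m j"
      by (intro mult_less_le_imp_less) (auto simp: less_imp_le)
    then have "mpar k + par m v * par m w < 0" using i j i'j' by simp
    then have "(par m w - par m v) * (mpar k + par m v * par m w) > 0"
      using wv by (intro mult_neg_neg) auto
    then show ?thesis using k v w by (simp add: base_vert orientation_circ_circ_mid)
  qed
  then show ?thesis using w wv by (intro bexI[of _ w]) auto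
qed

text \<open>The open half plane to the left of \<open>x y\<close>, enlarged by its boundary point
  \<open>y\<close>, is convex. It contains all other points but not \<open>x\<close>.\<close>

lemma extreme_point_if_hull_edge:
  assumes "finite S" "x \<in> S" "y \<in> S" "x \<noteq> y" and edge: "\<And>p. p \<in> S - {x, y} \<Longrightarrow> orientation x y p = 1"
  shows "x \<in> extreme_points S"
proof -
  define H where "H = insert y {p. area2 x y p > 0}"
  have comb: "area2 x y (u *\<^sub>R p + v *\<^sub>R q) = u * area2 x y p + v * area2 x y q"
    if "u + v = 1" for u v p q
  proof -
    have u: "u = 1 - v" using that by simp
    show ?thesis unfolding u by (simp add: area2_def algebra_simps)
  qed
  have y0: "area2 x y y = 0" "area2 x y x = 0" by (simp_all add: area2_def)
  have "convex H"
  proof (rule convexI)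
    fix p q and u v :: real assume *: "p \<in> H" "q \<in> H" "0 \<le> u" "0 \<le> v" "u + v = 1"
    consider "u = 0" | "v = 0" | "p = y" "q = y" | "u > 0" "v > 0" "p \<noteq> y \<or> q \<noteq> y"
      using * by linarith
    then show "u *\<^sub>R p + v *\<^sub>R q \<in> H"
    proof cases
      case 3
      then show ?thesis using * by (simp add: H_def scaleR_add_left[symmetric])
    next
      case 4
      then show ?thesis
        using * by (auto simp: H_def comb y0 intro: add_pos_pos)
    qed (use * in auto)
  qed
  moreover have "S - {x} \<subseteq> H"
  proof
    fix p assume "p \<in> S - {x}"
    then show "p \<in> H" using edge[of p] by (cases "p = y") (auto simp: H_def orientation_eq sgn_if split: if_splits)
  qed
  ultimately have "convex hull (S - {x}) \<subseteq> H" by (simp add: hull_minimal)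
  moreover have "x \<notin> H" using \<open>x \<noteq> y\<close> y0 by (simp add: H_def)
  ultimately have "x extreme_point_of (convex hull (insert x (S - {x})))"
    using \<open>finite S\<close> by (intro extreme_point_of_convex_hull_insert) auto
  then show ?thesis using \<open>x \<in> S\<close> by (simp add: extreme_points_def insert_absorb)
qed

lemma inscribable_pair_mono:
  assumes "inscribable_pair P B" "P' \<subseteq> P" "B' \<subseteq> B"
  shows "inscribable_pair P' B'"
proof -
  obtain f where f: "inj_on f P" "orientation_preserving_on P f" "f ` P \<subseteq> cball 0 1" "f ` B \<subseteq> sphere 0 1"
    using assms(1) by (auto simp: inscribable_pair_def)
  have "inj_on f P'" using f(1) assms(2) by (rule inj_on_subset)
  moreover have "orientation_preserving_on P' f"
    using f(2) assms(2) unfolding orientation_preserving_on_def by (meson subsetD)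
  moreover have "f ` P' \<subseteq> cball 0 1" using f(3) assms(2) by (meson image_mono order_trans)
  moreover have "f ` B' \<subseteq> sphere 0 1" using f(4) assms(3) by (meson image_mono order_trans)
  ultimately show ?thesis unfolding inscribable_pair_def by blast
qed

lemma orientation_scale:
  assumes "k > 0"
  shows "orientation (k *\<^sub>R (p - c)) (k *\<^sub>R (q - c)) (k *\<^sub>R (r - c)) = orientation p q r"
proof -
  have "area2 (k *\<^sub>R (p - c)) (k *\<^sub>R (q - c)) (k *\<^sub>R (r - c)) = k\<^sup>2 * area2 p q r"
    by (simp add: area2_def power2_eq_square algebra_simps)
  then show ?thesis using assms by (simp add: orientation_eq sgn_mult)
qed

text \<open>A similarity moves the circle to the unit circle, and the hull of the extreme points
  stays in the disk. The edge condition speaks of orientations only, so it survives in the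
  realization and makes the images of \<open>V\<close> extreme there.\<close>

lemma inscribable_imp_pair:
  assumes "inscribable M" "V \<subseteq> M"
    and edge: "\<And>v. v \<in> V \<Longrightarrow> \<exists>w\<in>M. w \<noteq> v \<and> (\<forall>p\<in>M - {v, w}. orientation v w p = 1)"
  shows "inscribable_pair M V"
proof -
  obtain Q f c \<rho> where Q: "finite Q" "bij_betw f M Q" "orientation_preserving_on M f" "0 < \<rho>"
    "extreme_points Q \<subseteq> sphere c \<rho>"
    using assms(1) by (auto simp: inscribable_def same_order_type_def)
  define g where "g x = (1 / \<rho>) *\<^sub>R (f x - c)" for x
  have fM: "f ` M = Q" and inj: "inj_on f M" using Q(2) by (auto simp: bij_betw_def)
  have norm_g: "norm (g x) = dist c (f x) / \<rho>" for x
    using Q(4) by (simp add: g_def dist_norm norm_minus_commute)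
  have "Q \<subseteq> convex hull Q" by (rule hull_subset)
  also have "\<dots> = convex hull (extreme_points Q)"
    using Krein_Milman_polytope[OF Q(1)] by (simp add: extreme_points_def)
  also have "\<dots> \<subseteq> cball c \<rho>" using Q(5) by (intro hull_minimal) auto
  finally have "norm (g x) \<le> 1" if "x \<in> M" for x
    using that fM Q(4) by (auto simp: norm_g)
  moreover have "norm (g v) = 1" if v: "v \<in> V" for v
  proof -
    obtain w where w: "w \<in> M" "w \<noteq> v" "\<forall>p\<in>M - {v, w}. orientation v w p = 1" using edge[OF v] by blast
    have "f v \<in> extreme_points Q"
    proof (rule extreme_point_if_hull_edge[of Q "f v" "f w"])
      show "f v \<noteq> f w" using inj w v assms(2) by (auto dest: inj_onD)
      fix p assume "p \<in> Q - {f v, f w}"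
      then obtain x where "x \<in> M - {v, w}" "p = f x" using fM by auto
      then show "orientation (f v) (f w) p = 1"
        using w v assms(2) Q(3) unfolding orientation_preserving_on_def by auto
    qed (use Q fM w v assms(2) in auto)
    then show ?thesis using Q(4,5) by (auto simp: norm_g)
  qed
  moreover have "inj_on g M" using inj Q(4) by (auto simp: g_def inj_on_def)
  moreover have "orientation_preserving_on M g"
    using Q(3,4) orientation_scale[of "1 / \<rho>"] by (simp add: orientation_preserving_on_def g_def)
  ultimately show ?thesis unfolding inscribable_pair_def by (intro exI[of _ g]) auto
qed

text \<open>Passing to a minimal uninscribable \<open>M\<close> that contains all vertices \<open>V\<close> of the hull keeps the
  set of extreme points, so only the deletion of vertices has to be checked by hand.\<close>

lemma ex_minimally_uninscribable:
  assumes "finite P" "V \<subseteq> P" "P \<subseteq> convex hull V"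
    and edge: "\<And>v. v \<in> V \<Longrightarrow> \<exists>w\<in>V. w \<noteq> v \<and> (\<forall>p\<in>P - {v, w}. orientation v w p = 1)"
    and not_pair: "\<not> inscribable_pair P V"
    and delete: "\<And>v. v \<in> V \<Longrightarrow> inscribable_pair (P - {v}) (V - {v})"
  shows "\<exists>M. V \<subseteq> M \<and> minimally_uninscribable M"
proof -
  define \<M> where "\<M> = {M. V \<subseteq> M \<and> M \<subseteq> P \<and> \<not> inscribable_pair M V}"
  have "finite \<M>" by (rule finite_subset[of _ "Pow P"]) (use assms(1) in \<open>auto simp: \<M>_def\<close>)
  moreover have "\<M> \<noteq> {}" using assms(2) not_pair by (auto simp: \<M>_def)
  ultimately obtain M where "M \<in> \<M>" and least: "\<And>N. N \<in> \<M> \<Longrightarrow> N \<subseteq> M \<Longrightarrow> M = N"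
    using finite_has_minimal[of \<M>] by blast
  then have M: "V \<subseteq> M" "M \<subseteq> P" "\<not> inscribable_pair M V" by (auto simp: \<M>_def)
  have "\<not> inscribable M"
  proof
    assume "inscribable M"
    then have "inscribable_pair M V"
    proof (rule inscribable_imp_pair[OF _ M(1)])
      fix v assume "v \<in> V"
      then show "\<exists>w\<in>M. w \<noteq> v \<and> (\<forall>p\<in>M - {v, w}. orientation v w p = 1)"
        using edge[of v] M by blast
    qed
    with M show False by blast
  qed
  moreover have "extreme_points M \<subseteq> V"
  proof -
    have "convex hull M = convex hull V"
    proof (rule antisym)
      show "convex hull M \<subseteq> convex hull V" using M assms(3) by (intro hull_minimal) auto
    qed (use M in \<open>simp add: hull_mono\<close>)
    then show ?thesis using extreme_points_of_convex_hull[of V] by (simp add: extreme_points_def)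
  qed
  moreover have "inscribable_pair P' B'" if "P' \<subset> M" "B' \<subseteq> P'" "B' \<subseteq> V" for P' B'
  \<comment> \<open>With all of \<open>V\<close> present, minimality of \<open>M\<close> applies;
    otherwise a vertex is missing and \<open>delete\<close> covers \<open>P'\<close>.\<close>
  proof (cases "V \<subseteq> P'")
    case True
    then have "inscribable_pair P' V" using that M least[of P'] by (auto simp: \<M>_def)
    then show ?thesis using inscribable_pair_mono that by blast
  next
    case False
    then obtain v where "v \<in> V" "v \<notin> P'" by blast
    then show ?thesis
      using that M by (intro inscribable_pair_mono[OF delete[of v]]) auto
  qed
  ultimately have "minimally_uninscribable M"
    using finite_subset[OF M(2) assms(1)] unfolding minimally_uninscribable_def
    by (meson subset_trans)
  with M show ?thesis by blast
qed

text \<open>The minimal configuration may lose some of the \<open>Mid\<close> points but keeps all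
  \<open>2 * m\<close> vertices, which bounds its size from below.\<close>

lemma ex_large_minimally_uninscribable:
  assumes m: "m \<ge> 3"
  shows "\<exists>M. minimally_uninscribable M \<and> 2 * m \<le> card M"
proof -
  obtain z where z: "realizes m (inds m) z" using ex_realization[OF m] by blast
  define P V where "P = z ` inds m" and "V = z ` verts m"
  have "Up 0 \<in> verts m" using m by simp
  then have inj: "inj_on z (inds m)" using realizes_inj[OF m order.refl _ _ z] by (meson Diff_subset)
  have VP: "V \<subseteq> P" using verts_subset_inds by (auto simp: P_def V_def)
  have "P \<subseteq> convex hull V"
  proof
    fix p assume "p \<in> P"
    then consider "p \<in> V" | k where "k < m" "p = z (Mid k)" by (auto simp: P_def V_def inds_def)
    then show "p \<in> convex hull V"
    proof cases
      case 1
      then show ?thesis by (simp add: hull_inc)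
    next
      case 2
      then have "p \<in> convex hull {z (Up k), z (Low k)}"
        using necklace_between[OF realizes_necklace[OF m z]]
        by (auto simp: segment_convex_hull[symmetric] open_closed_segment)
      moreover have "{z (Up k), z (Low k)} \<subseteq> V" using 2 by (auto simp: V_def)
      ultimately show ?thesis using hull_mono by blast
    qed
  qed
  moreover have "\<exists>w\<in>V. w \<noteq> v \<and> (\<forall>p\<in>P - {v, w}. orientation v w p = 1)" if "v \<in> V" for v
  proof -
    obtain i where i: "i \<in> verts m" "v = z i" using \<open>v \<in> V\<close> by (auto simp: V_def)
    then obtain j where j: "j \<in> verts m" "j \<noteq> i"
      "\<forall>p\<in>inds m - {i, j}. orientation (base m i) (base m j) (base m p) = 1"
      using base_hull_edge[OF m] by blast
    have ij: "i \<in> inds m" "j \<in> inds m" using i j verts_subset_inds by auto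
    have "orientation (z i) (z j) (z p) = 1" if "p \<in> inds m - {i, j}" for p
      using realizes_generic[OF z ij, of p] j(3) that by simp
    moreover have "z j \<noteq> z i" using inj ij j(2) by (auto dest: inj_onD)
    ultimately show ?thesis using i j by (auto simp: V_def P_def)
  qed
  moreover have "\<not> inscribable_pair P V"
  proof
    assume "inscribable_pair P V"
    then obtain f where f: "orientation_preserving_on P f" "f ` V \<subseteq> sphere 0 1"
      by (auto simp: inscribable_pair_def)
    have "realizes m (inds m) (f \<circ> z)"
      using z by (rule realizes_transfer) (use f(1) in \<open>simp add: orientation_preserving_on_def P_def\<close>)
    moreover have "(f \<circ> z) i \<in> sphere 0 1" if "i \<in> verts m" for i
    proof -
      have "f (z i) \<in> f ` V" using that by (simp add: V_def)
      then show ?thesis using f(2) by auto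
    qed
    ultimately show False
      using necklace_not_inscribed[OF m realizes_necklace[OF m]] by (metis inds_simps(4,5))
  qed
  moreover have "inscribable_pair (P - {v}) (V - {v})" if "v \<in> V" for v
  proof -
    obtain i where i: "i \<in> verts m" "v = z i" using \<open>v \<in> V\<close> by (auto simp: V_def)
    define J where "J = inds m - {i}"
    obtain w where w: "realizes m J w" "w ` inds m \<subseteq> cball 0 1" "w ` verts m \<subseteq> sphere 0 1"
      using ex_inscribed_realization_delete[OF m i(1)] by (auto simp: J_def)
    have zJ: "realizes m J z" using z by (rule realizes_subset) (auto simp: J_def)
    have injJ: "inj_on z J" "inj_on w J"
      using realizes_inj[OF m _ _ i(1), of J] zJ w(1) by (auto simp: J_def)
    have Pv: "P - {v} = z ` J"
      using inj i verts_subset_inds by (auto simp: P_def J_def dest: inj_onD)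
    have Vv: "V - {v} = z ` (verts m - {i})"
      using inj i verts_subset_inds by (auto simp: V_def dest: inj_onD)
    \<comment> \<open>On \<open>J\<close> both \<open>z\<close> and \<open>w\<close> realize the
      same order type, so matching labels gives the required inscription.\<close>
    define f where "f = w \<circ> inv_into J z"
    have fz: "f (z j) = w j" if "j \<in> J" for j using injJ that by (simp add: f_def)
    have "verts m - {i} \<subseteq> J" using verts_subset_inds by (auto simp: J_def)
    then have "f ` (V - {v}) \<subseteq> sphere 0 1" using w(3) fz unfolding Vv by (auto simp: subset_iff)
    moreover have "f ` (P - {v}) \<subseteq> cball 0 1" using w(2) fz unfolding Pv by (auto simp: J_def)
    moreover have "inj_on f (P - {v})"
      unfolding Pv using injJ(2) fz by (auto simp: inj_on_def)
    moreover have "orientation_preserving_on (P - {v}) f"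
      unfolding Pv orientation_preserving_on_def
      using fz realizes_same_orientation[OF m _ w(1) zJ] by (auto simp: J_def)
    ultimately show ?thesis unfolding inscribable_pair_def by blast
  qed
  ultimately obtain M where M: "V \<subseteq> M" "minimally_uninscribable M"
    using ex_minimally_uninscribable[of P V] VP by (auto simp: P_def)
  have "card V = 2 * m"
    using inj_on_subset[OF inj verts_subset_inds] by (simp add: V_def card_image card_verts)
  then have "2 * m \<le> card M"
    using M card_mono[of M V] by (simp add: minimally_uninscribable_def)
  with M show ?thesis by blast
qed

text \<open>Cardinality is an invariant of order types and is unbounded on the minimally
  uninscribable ones.\<close>

theorem theorem1p4: "infinite {T. minimally_uninscribable_order_type T}"
proof
  assume fin: "finite {T. minimally_uninscribable_order_type T}"
  define size where "size T = card (SOME P. P \<in> T)" for T :: "(real^2) set set"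
  define N where "N = Max (insert 0 (size ` {T. minimally_uninscribable_order_type T}))"
  \<comment> \<open>The summand 3 meets the bound on \<open>m\<close> and pushes the size beyond
    \<open>N\<close>.\<close>
  obtain M where M: "minimally_uninscribable M" "2 * (N + 3) \<le> card M"
    using ex_large_minimally_uninscribable[of "N + 3"] by auto
  then have finM: "finite M" by (simp add: minimally_uninscribable_def)
  define T where "T = order_type_rel `` {M}"
  have MT: "M \<in> T"
    using equiv_class_self[OF equiv_order_type_rel] finM by (simp add: T_def)
  have "T \<in> order_types"
    using finM by (auto simp: T_def order_types_def intro: quotientI)
  then have T: "minimally_uninscribable_order_type T"
    using MT M by (auto simp: minimally_uninscribable_order_type_def)
  have "card P = card M" if "P \<in> T" for P
    using that by (auto simp: T_def order_type_rel_def same_order_type_def dest: bij_betw_same_card)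
  moreover have "(SOME P. P \<in> T) \<in> T" using MT by (rule someI)
  ultimately have "size T = card M" by (simp add: size_def)
  moreover have "size T \<le> N" unfolding N_def using T fin by (intro Max_ge) auto
  ultimately show False using M by simp
qed

end
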